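(* Let $A:\mathcal U^e$ be an exo-type such that for any type family $Y:A\to\mathcal U$ the exo-type $\prod^e_{a:A}Y(a)$ is fibrant; for each $Y$ write $FM_Y:\mathcal U$ for its fibrant match, with mutually inverse exo-isomorphisms $r_Y:\prod^e_{a:A}Y(a)\to FM_Y$ and $s_Y:FM_Y\to\prod^e_{a:A}Y(a)$. Then the following are (logically) equivalent: (i) For any $Y:A\to\mathcal U$, if $Y(a)$ is contractible for each $a:A$, then the fibrant match $FM_Y$ of $\prod^e_{a:A}Y(a)$ is contractible (that is, $A$ is cofibrant). (ii) (Function extensionality for cofibrant types.) For any $Y:A\to\mathcal U$ and any $f,g:\prod^e_{a:A}Y(a)$, if $f(a)=g(a)$ for each $a:A$, then $r_Y(f)=r_Y(g)$ in $FM_Y$.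
   Context: Setting: two-level type theory (2LTT). There is a hierarchy of universes $\mathcal U$ whose terms are called types and which obeys homotopy type theory (with the usual $\prod,\sum,+,\mathbf 1,\mathbf 0,\mathbb N$ and identity type $=$), and a hierarchy of exo-universes $\mathcal U^e$ whose terms are called exo-types, with their own formers $\prod^e,\sum^e,+^e,\mathbf 1^e,\mathbf 0^e,\mathbb N^e$ and exo-equality $=^e$. Every type is also an exo-type. Exo-level inductive exo-types eliminate into arbitrary exo-types, while inductive types eliminate only into types. Axioms: univalence (hence function extensionality) for $=$; function extensionality and uniqueness of identity proofs for $=^e$. Exo-equality between terms of a type implies identity. An exo-isomorphism $A\cong B$ of exo-types consists of $f:A\to B$, $g:B\to A$ with $f\circ g=^e\mathrm{id}_B$ and $g\circ f=^e\mathrm{id}_A$. An exo-type $A$ is fibrant if there is a type $RA:\mathcal U$ (called its fibrant match) with $A\cong RA$. Contractible means contractible with respect to $=$. An exo-type $A$ is cofibrant if (1) for any $Y:A\to\mathcal U$ the exo-type $\prod^e_{a:A}Y(a)$ is fibrant, and (2) in that case, if each $Y(a)$ is contractible, then so is the fibrant match of $\prod^e_{a:A}Y(a)$. *)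

theory Defs
  imports Main
begin

section \<open>Raw syntax\<close>

text \<open>
  Two-level type theory is treated as a formal system, given by raw terms (de Bruijn indices) and
  inductively defined judgements. A shallow rendering, with the exo-types being the types or sets
  of HOL, is not available: excluded middle for the exo-level contradicts univalence.

  Every former exists in two copies: layer \<open>Inn\<close> is the homotopy type theory of the universes
  \<open>U_i = Univ Inn i\<close> (types), layer \<open>Exo\<close> that of the exo-universes \<open>U^e_i = Univ Exo i\<close> (exo-types).
\<close>

datatype layer = Inn | Exo

datatype const =
    Univalence nat
  | FunextExo nat
  | UipExo nat

text \<open>
  Binding: the second argument of \<open>Pi\<close>, \<open>Lam\<close>, \<open>Sig\<close> is under one binder. The first term argument
  of an eliminator is its motive; it binds the eliminated element (for \<open>EqElim\<close>: the two endpoints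
  and the identification). The next arguments are the branches; they bind the arguments of
  the constructor (for the successor branch of \<open>NatElim\<close>: the predecessor and the recursive value).
\<close>

datatype tm =
    Var nat
  | Const const
  | Univ layer nat
  | Pi layer tm tm | Lam layer tm tm | App layer tm tm
  | Sig layer tm tm | Pair layer tm tm | SigElim layer tm tm tm
  | Coprod layer tm tm | InL layer tm | InR layer tm | CoprodElim layer tm tm tm tm
  | One layer | Star layer | OneElim layer tm tm tm
  | Void layer | VoidElim layer tm tm
  | NatTy layer | Zero layer | Succ layer tm | NatElim layer tm tm tm tm
  | Eq layer tm tm tm | Refl layer tm | EqElim layer tm tm tm tm tm

subsection \<open>Substitution\<close>

definition scons :: "'a \<Rightarrow> (nat \<Rightarrow> 'a) \<Rightarrow> nat \<Rightarrow> 'a" (infixr "\<cdot>" 65) where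
  "a \<cdot> \<sigma> = (\<lambda>n. case n of 0 \<Rightarrow> a | Suc m \<Rightarrow> \<sigma> m)"

definition up_ren :: "(nat \<Rightarrow> nat) \<Rightarrow> nat \<Rightarrow> nat" where
  "up_ren r = 0 \<cdot> (\<lambda>n. Suc (r n))"

primrec ren :: "(nat \<Rightarrow> nat) \<Rightarrow> tm \<Rightarrow> tm" where
  "ren r (Var n) = Var (r n)"
| "ren r (Const c) = Const c"
| "ren r (Univ s i) = Univ s i"
| "ren r (Pi s A B) = Pi s (ren r A) (ren (up_ren r) B)"
| "ren r (Lam s A b) = Lam s (ren r A) (ren (up_ren r) b)"
| "ren r (App s f a) = App s (ren r f) (ren r a)"
| "ren r (Sig s A B) = Sig s (ren r A) (ren (up_ren r) B)"
| "ren r (Pair s a b) = Pair s (ren r a) (ren r b)"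
| "ren r (SigElim s C g p) =
     SigElim s (ren (up_ren r) C) (ren (up_ren (up_ren r)) g) (ren r p)"
| "ren r (Coprod s A B) = Coprod s (ren r A) (ren r B)"
| "ren r (InL s a) = InL s (ren r a)"
| "ren r (InR s b) = InR s (ren r b)"
| "ren r (CoprodElim s C c d e) =
     CoprodElim s (ren (up_ren r) C) (ren (up_ren r) c) (ren (up_ren r) d) (ren r e)"
| "ren r (One s) = One s"
| "ren r (Star s) = Star s"
| "ren r (OneElim s C c a) = OneElim s (ren (up_ren r) C) (ren r c) (ren r a)"
| "ren r (Void s) = Void s"
| "ren r (VoidElim s C a) = VoidElim s (ren (up_ren r) C) (ren r a)"
| "ren r (NatTy s) = NatTy s"
| "ren r (Zero s) = Zero s"
| "ren r (Succ s n) = Succ s (ren r n)"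
| "ren r (NatElim s C z c n) =
     NatElim s (ren (up_ren r) C) (ren r z) (ren (up_ren (up_ren r)) c) (ren r n)"
| "ren r (Eq s A a b) = Eq s (ren r A) (ren r a) (ren r b)"
| "ren r (Refl s a) = Refl s (ren r a)"
| "ren r (EqElim s C c a b p) =
     EqElim s (ren (up_ren (up_ren (up_ren r))) C) (ren (up_ren r) c) (ren r a) (ren r b) (ren r p)"

abbreviation lift :: "tm \<Rightarrow> tm" where
  "lift \<equiv> ren Suc"

definition up :: "(nat \<Rightarrow> tm) \<Rightarrow> nat \<Rightarrow> tm" where
  "up \<sigma> = Var 0 \<cdot> (\<lambda>n. lift (\<sigma> n))"

primrec subst :: "(nat \<Rightarrow> tm) \<Rightarrow> tm \<Rightarrow> tm" where
  "subst \<sigma> (Var n) = \<sigma> n"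
| "subst \<sigma> (Const c) = Const c"
| "subst \<sigma> (Univ s i) = Univ s i"
| "subst \<sigma> (Pi s A B) = Pi s (subst \<sigma> A) (subst (up \<sigma>) B)"
| "subst \<sigma> (Lam s A b) = Lam s (subst \<sigma> A) (subst (up \<sigma>) b)"
| "subst \<sigma> (App s f a) = App s (subst \<sigma> f) (subst \<sigma> a)"
| "subst \<sigma> (Sig s A B) = Sig s (subst \<sigma> A) (subst (up \<sigma>) B)"
| "subst \<sigma> (Pair s a b) = Pair s (subst \<sigma> a) (subst \<sigma> b)"
| "subst \<sigma> (SigElim s C g p) =
     SigElim s (subst (up \<sigma>) C) (subst (up (up \<sigma>)) g) (subst \<sigma> p)"
| "subst \<sigma> (Coprod s A B) = Coprod s (subst \<sigma> A) (subst \<sigma> B)"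
| "subst \<sigma> (InL s a) = InL s (subst \<sigma> a)"
| "subst \<sigma> (InR s b) = InR s (subst \<sigma> b)"
| "subst \<sigma> (CoprodElim s C c d e) =
     CoprodElim s (subst (up \<sigma>) C) (subst (up \<sigma>) c) (subst (up \<sigma>) d) (subst \<sigma> e)"
| "subst \<sigma> (One s) = One s"
| "subst \<sigma> (Star s) = Star s"
| "subst \<sigma> (OneElim s C c a) = OneElim s (subst (up \<sigma>) C) (subst \<sigma> c) (subst \<sigma> a)"
| "subst \<sigma> (Void s) = Void s"
| "subst \<sigma> (VoidElim s C a) = VoidElim s (subst (up \<sigma>) C) (subst \<sigma> a)"
| "subst \<sigma> (NatTy s) = NatTy s"
| "subst \<sigma> (Zero s) = Zero s"
| "subst \<sigma> (Succ s n) = Succ s (subst \<sigma> n)"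
| "subst \<sigma> (NatElim s C z c n) =
     NatElim s (subst (up \<sigma>) C) (subst \<sigma> z) (subst (up (up \<sigma>)) c) (subst \<sigma> n)"
| "subst \<sigma> (Eq s A a b) = Eq s (subst \<sigma> A) (subst \<sigma> a) (subst \<sigma> b)"
| "subst \<sigma> (Refl s a) = Refl s (subst \<sigma> a)"
| "subst \<sigma> (EqElim s C c a b p) =
     EqElim s (subst (up (up (up \<sigma>))) C) (subst (up \<sigma>) c) (subst \<sigma> a) (subst \<sigma> b) (subst \<sigma> p)"

definition shift :: "nat \<Rightarrow> nat \<Rightarrow> tm" where
  "shift k = (\<lambda>n. Var (n + k))"

abbreviation inst :: "tm \<Rightarrow> tm \<Rightarrow> tm" where
  "inst t a \<equiv> subst (a \<cdot> Var) t"

section \<open>Derived formers\<close>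

definition arr :: "layer \<Rightarrow> tm \<Rightarrow> tm \<Rightarrow> tm" where
  "arr s A B = Pi s A (lift B)"

definition times :: "layer \<Rightarrow> tm \<Rightarrow> tm \<Rightarrow> tm" where
  "times s A B = Sig s A (lift B)"

definition idfun :: "layer \<Rightarrow> tm \<Rightarrow> tm" where
  "idfun s A = Lam s A (Var 0)"

text \<open>\<open>comp s A f g\<close> is \<open>f \<circ> g\<close>, where \<open>A\<close> is the domain of \<open>g\<close>.\<close>

definition comp :: "layer \<Rightarrow> tm \<Rightarrow> tm \<Rightarrow> tm \<Rightarrow> tm" where
  "comp s A f g = Lam s A (App s (lift f) (App s (lift g) (Var 0)))"

text \<open>Projections of \<open>p : Sig s A B\<close>.\<close>

definition proj1 :: "layer \<Rightarrow> tm \<Rightarrow> tm \<Rightarrow> tm" where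
  "proj1 s A p = SigElim s (lift A) (Var 1) p"

definition proj2 :: "layer \<Rightarrow> tm \<Rightarrow> tm \<Rightarrow> tm \<Rightarrow> tm" where
  "proj2 s A B p =
     SigElim s (subst (proj1 s (lift A) (Var 0) \<cdot> shift 1) B) (Var 0) p"

text \<open>The exo-type of elements \<open>(a : A) \<rightarrow> Y a\<close> of a family \<open>Y\<close> over an exo-type \<open>A\<close>.\<close>

definition pi_exo :: "tm \<Rightarrow> tm \<Rightarrow> tm" where
  "pi_exo A Y = Pi Exo A (App Exo (lift Y) (Var 0))"

subsection \<open>Contractibility and equivalences of types\<close>

definition is_contr :: "tm \<Rightarrow> tm" where
  "is_contr A = Sig Inn A (Pi Inn (lift A) (Eq Inn (lift (lift A)) (Var 1) (Var 0)))"

text \<open>Equivalences of types are bi-invertible maps.\<close>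

definition is_equiv :: "tm \<Rightarrow> tm \<Rightarrow> tm \<Rightarrow> tm" where
  "is_equiv A B f =
     times Inn
       (Sig Inn (arr Inn B A)
          (Pi Inn (lift B)
             (Eq Inn (lift (lift B)) (App Inn (lift (lift f)) (App Inn (Var 1) (Var 0))) (Var 0))))
       (Sig Inn (arr Inn B A)
          (Pi Inn (lift A)
             (Eq Inn (lift (lift A)) (App Inn (Var 1) (App Inn (lift (lift f)) (Var 0))) (Var 0))))"

definition equiv :: "tm \<Rightarrow> tm \<Rightarrow> tm" where
  "equiv A B = Sig Inn (arr Inn A B) (is_equiv (lift A) (lift B) (Var 0))"

definition id_equiv :: "tm \<Rightarrow> tm" where
  "id_equiv A =
     Pair Inn (idfun Inn A)
       (Pair Inn (Pair Inn (idfun Inn A) (Lam Inn A (Refl Inn (Var 0))))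
                 (Pair Inn (idfun Inn A) (Lam Inn A (Refl Inn (Var 0)))))"

definition id_to_equiv :: "nat \<Rightarrow> tm \<Rightarrow> tm \<Rightarrow> tm" where
  "id_to_equiv i A B =
     Lam Inn (Eq Inn (Univ Inn i) A B)
       (EqElim Inn (equiv (Var 2) (Var 1)) (id_equiv (Var 0)) (lift A) (lift B) (Var 0))"

subsection \<open>Axioms\<close>

text \<open>
  In order: univalence for \<open>U_i\<close> (the map \<open>id_to_equiv\<close> is an equivalence for all \<open>A B : U_i\<close>);
  function extensionality and uniqueness of identity proofs for exo-equality in \<open>U^e_i\<close>.
\<close>

primrec const_type :: "const \<Rightarrow> tm" where
  "const_type (Univalence i) =
     Pi Inn (Univ Inn i) (Pi Inn (Univ Inn i)
       (is_equiv (Eq Inn (Univ Inn i) (Var 1) (Var 0)) (equiv (Var 1) (Var 0))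
                 (id_to_equiv i (Var 1) (Var 0))))"
| "const_type (FunextExo i) =
     Pi Exo (Univ Exo i) (Pi Exo (arr Exo (Var 0) (Univ Exo i))
       (Pi Exo (pi_exo (Var 1) (Var 0)) (Pi Exo (pi_exo (Var 2) (Var 1))
         (arr Exo
            (Pi Exo (Var 3)
               (Eq Exo (App Exo (Var 3) (Var 0)) (App Exo (Var 2) (Var 0)) (App Exo (Var 1) (Var 0))))
            (Eq Exo (pi_exo (Var 3) (Var 2)) (Var 1) (Var 0))))))"
| "const_type (UipExo i) =
     Pi Exo (Univ Exo i) (Pi Exo (Var 0) (Pi Exo (Var 1)
       (Pi Exo (Eq Exo (Var 2) (Var 1) (Var 0)) (Pi Exo (Eq Exo (Var 3) (Var 2) (Var 1))
         (Eq Exo (Eq Exo (Var 4) (Var 3) (Var 2)) (Var 1) (Var 0))))))"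

section \<open>Judgements\<close>

text \<open>
  Contexts are lists of exo-types, most recent variable first. Each layer has the rules of
  homotopy type theory; the layers are linked only by the subsumption of \<open>U_i\<close> under \<open>U^e_i\<close>
  (rules \<open>exo\<close> and \<open>eq_exo\<close>). Hence every former and every motive in the rules for layer \<open>Exo\<close>
  may involve types, whereas a former or an eliminator of layer \<open>Inn\<close> requires types:
  its components and its motive are terms of a universe \<open>Univ Inn j\<close>.
\<close>

inductive
  ctx :: "tm list \<Rightarrow> bool" and
  typing :: "tm list \<Rightarrow> tm \<Rightarrow> tm \<Rightarrow> bool" ("_ \<turnstile> _ \<Colon> _" [50, 50, 50] 50) and
  conv :: "tm list \<Rightarrow> tm \<Rightarrow> tm \<Rightarrow> tm \<Rightarrow> bool" ("_ \<turnstile> _ \<doteq> _ \<Colon> _" [50, 50, 50, 50] 50)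
where
  ctx_nil: "ctx []"
| ctx_cons: "\<Gamma> \<turnstile> A \<Colon> Univ s i \<Longrightarrow> ctx (A # \<Gamma>)"

  \<comment> \<open>structural rules and universes\<close>
| var: "ctx \<Gamma> \<Longrightarrow> n < length \<Gamma> \<Longrightarrow> \<Gamma> \<turnstile> Var n \<Colon> ren (\<lambda>m. m + Suc n) (\<Gamma> ! n)"
| const: "ctx \<Gamma> \<Longrightarrow> \<Gamma> \<turnstile> Const c \<Colon> const_type c"
| univ: "ctx \<Gamma> \<Longrightarrow> \<Gamma> \<turnstile> Univ s i \<Colon> Univ s (Suc i)"
| cumul: "\<Gamma> \<turnstile> A \<Colon> Univ s i \<Longrightarrow> \<Gamma> \<turnstile> A \<Colon> Univ s (Suc i)"
| exo: "\<Gamma> \<turnstile> A \<Colon> Univ Inn i \<Longrightarrow> \<Gamma> \<turnstile> A \<Colon> Univ Exo i"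
| retype: "\<Gamma> \<turnstile> a \<Colon> A \<Longrightarrow> \<Gamma> \<turnstile> A \<doteq> B \<Colon> Univ s i \<Longrightarrow> \<Gamma> \<turnstile> a \<Colon> B"

| eq_refl: "\<Gamma> \<turnstile> a \<Colon> A \<Longrightarrow> \<Gamma> \<turnstile> a \<doteq> a \<Colon> A"
| eq_sym: "\<Gamma> \<turnstile> a \<doteq> b \<Colon> A \<Longrightarrow> \<Gamma> \<turnstile> b \<doteq> a \<Colon> A"
| eq_trans: "\<Gamma> \<turnstile> a \<doteq> b \<Colon> A \<Longrightarrow> \<Gamma> \<turnstile> b \<doteq> c \<Colon> A \<Longrightarrow> \<Gamma> \<turnstile> a \<doteq> c \<Colon> A"
| eq_cumul: "\<Gamma> \<turnstile> A \<doteq> B \<Colon> Univ s i \<Longrightarrow> \<Gamma> \<turnstile> A \<doteq> B \<Colon> Univ s (Suc i)"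
| eq_exo: "\<Gamma> \<turnstile> A \<doteq> B \<Colon> Univ Inn i \<Longrightarrow> \<Gamma> \<turnstile> A \<doteq> B \<Colon> Univ Exo i"
| eq_retype: "\<Gamma> \<turnstile> a \<doteq> b \<Colon> A \<Longrightarrow> \<Gamma> \<turnstile> A \<doteq> B \<Colon> Univ s i \<Longrightarrow> \<Gamma> \<turnstile> a \<doteq> b \<Colon> B"

  \<comment> \<open>dependent functions\<close>
| pi_form: "\<Gamma> \<turnstile> A \<Colon> Univ s i \<Longrightarrow> A # \<Gamma> \<turnstile> B \<Colon> Univ s i \<Longrightarrow> \<Gamma> \<turnstile> Pi s A B \<Colon> Univ s i"
| pi_intro: "\<Gamma> \<turnstile> A \<Colon> Univ s i \<Longrightarrow> A # \<Gamma> \<turnstile> B \<Colon> Univ s i \<Longrightarrow> A # \<Gamma> \<turnstile> b \<Colon> B \<Longrightarrow>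
    \<Gamma> \<turnstile> Lam s A b \<Colon> Pi s A B"
| pi_elim: "\<Gamma> \<turnstile> f \<Colon> Pi s A B \<Longrightarrow> \<Gamma> \<turnstile> a \<Colon> A \<Longrightarrow> \<Gamma> \<turnstile> App s f a \<Colon> inst B a"
| pi_beta: "\<Gamma> \<turnstile> A \<Colon> Univ s i \<Longrightarrow> A # \<Gamma> \<turnstile> B \<Colon> Univ s i \<Longrightarrow> A # \<Gamma> \<turnstile> b \<Colon> B \<Longrightarrow> \<Gamma> \<turnstile> a \<Colon> A \<Longrightarrow>
    \<Gamma> \<turnstile> App s (Lam s A b) a \<doteq> inst b a \<Colon> inst B a"
| pi_eta: "\<Gamma> \<turnstile> f \<Colon> Pi s A B \<Longrightarrow> \<Gamma> \<turnstile> f \<doteq> Lam s A (App s (lift f) (Var 0)) \<Colon> Pi s A B"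
| eq_pi: "\<Gamma> \<turnstile> A \<doteq> A' \<Colon> Univ s i \<Longrightarrow> A # \<Gamma> \<turnstile> B \<doteq> B' \<Colon> Univ s i \<Longrightarrow>
    \<Gamma> \<turnstile> Pi s A B \<doteq> Pi s A' B' \<Colon> Univ s i"
| eq_lam: "\<Gamma> \<turnstile> A \<doteq> A' \<Colon> Univ s i \<Longrightarrow> A # \<Gamma> \<turnstile> B \<Colon> Univ s i \<Longrightarrow> A # \<Gamma> \<turnstile> b \<doteq> b' \<Colon> B \<Longrightarrow>
    \<Gamma> \<turnstile> Lam s A b \<doteq> Lam s A' b' \<Colon> Pi s A B"
| eq_app: "\<Gamma> \<turnstile> f \<doteq> f' \<Colon> Pi s A B \<Longrightarrow> \<Gamma> \<turnstile> a \<doteq> a' \<Colon> A \<Longrightarrow>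
    \<Gamma> \<turnstile> App s f a \<doteq> App s f' a' \<Colon> inst B a"

  \<comment> \<open>dependent pairs\<close>
| sig_form: "\<Gamma> \<turnstile> A \<Colon> Univ s i \<Longrightarrow> A # \<Gamma> \<turnstile> B \<Colon> Univ s i \<Longrightarrow> \<Gamma> \<turnstile> Sig s A B \<Colon> Univ s i"
| sig_intro: "\<Gamma> \<turnstile> A \<Colon> Univ s i \<Longrightarrow> A # \<Gamma> \<turnstile> B \<Colon> Univ s i \<Longrightarrow> \<Gamma> \<turnstile> a \<Colon> A \<Longrightarrow> \<Gamma> \<turnstile> b \<Colon> inst B a \<Longrightarrow>
    \<Gamma> \<turnstile> Pair s a b \<Colon> Sig s A B"
| sig_elim: "Sig s A B # \<Gamma> \<turnstile> C \<Colon> Univ s j \<Longrightarrow>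
    B # A # \<Gamma> \<turnstile> g \<Colon> subst (Pair s (Var 1) (Var 0) \<cdot> shift 2) C \<Longrightarrow>
    \<Gamma> \<turnstile> p \<Colon> Sig s A B \<Longrightarrow>
    \<Gamma> \<turnstile> SigElim s C g p \<Colon> inst C p"
| sig_beta: "\<Gamma> \<turnstile> A \<Colon> Univ s i \<Longrightarrow> A # \<Gamma> \<turnstile> B \<Colon> Univ s i \<Longrightarrow> Sig s A B # \<Gamma> \<turnstile> C \<Colon> Univ s j \<Longrightarrow>
    B # A # \<Gamma> \<turnstile> g \<Colon> subst (Pair s (Var 1) (Var 0) \<cdot> shift 2) C \<Longrightarrow>
    \<Gamma> \<turnstile> a \<Colon> A \<Longrightarrow> \<Gamma> \<turnstile> b \<Colon> inst B a \<Longrightarrow>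
    \<Gamma> \<turnstile> SigElim s C g (Pair s a b) \<doteq> subst (b \<cdot> a \<cdot> Var) g \<Colon> inst C (Pair s a b)"
| eq_sig: "\<Gamma> \<turnstile> A \<doteq> A' \<Colon> Univ s i \<Longrightarrow> A # \<Gamma> \<turnstile> B \<doteq> B' \<Colon> Univ s i \<Longrightarrow>
    \<Gamma> \<turnstile> Sig s A B \<doteq> Sig s A' B' \<Colon> Univ s i"
| eq_pair: "\<Gamma> \<turnstile> A \<Colon> Univ s i \<Longrightarrow> A # \<Gamma> \<turnstile> B \<Colon> Univ s i \<Longrightarrow>
    \<Gamma> \<turnstile> a \<doteq> a' \<Colon> A \<Longrightarrow> \<Gamma> \<turnstile> b \<doteq> b' \<Colon> inst B a \<Longrightarrow>
    \<Gamma> \<turnstile> Pair s a b \<doteq> Pair s a' b' \<Colon> Sig s A B"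
| eq_sig_elim: "Sig s A B # \<Gamma> \<turnstile> C \<doteq> C' \<Colon> Univ s j \<Longrightarrow>
    B # A # \<Gamma> \<turnstile> g \<doteq> g' \<Colon> subst (Pair s (Var 1) (Var 0) \<cdot> shift 2) C \<Longrightarrow>
    \<Gamma> \<turnstile> p \<doteq> p' \<Colon> Sig s A B \<Longrightarrow>
    \<Gamma> \<turnstile> SigElim s C g p \<doteq> SigElim s C' g' p' \<Colon> inst C p"

  \<comment> \<open>coproducts\<close>
| coprod_form: "\<Gamma> \<turnstile> A \<Colon> Univ s i \<Longrightarrow> \<Gamma> \<turnstile> B \<Colon> Univ s i \<Longrightarrow> \<Gamma> \<turnstile> Coprod s A B \<Colon> Univ s i"
| coprod_intro1: "\<Gamma> \<turnstile> A \<Colon> Univ s i \<Longrightarrow> \<Gamma> \<turnstile> B \<Colon> Univ s i \<Longrightarrow> \<Gamma> \<turnstile> a \<Colon> A \<Longrightarrow>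
    \<Gamma> \<turnstile> InL s a \<Colon> Coprod s A B"
| coprod_intro2: "\<Gamma> \<turnstile> A \<Colon> Univ s i \<Longrightarrow> \<Gamma> \<turnstile> B \<Colon> Univ s i \<Longrightarrow> \<Gamma> \<turnstile> b \<Colon> B \<Longrightarrow>
    \<Gamma> \<turnstile> InR s b \<Colon> Coprod s A B"
| coprod_elim: "Coprod s A B # \<Gamma> \<turnstile> C \<Colon> Univ s j \<Longrightarrow>
    A # \<Gamma> \<turnstile> c \<Colon> subst (InL s (Var 0) \<cdot> shift 1) C \<Longrightarrow>
    B # \<Gamma> \<turnstile> d \<Colon> subst (InR s (Var 0) \<cdot> shift 1) C \<Longrightarrow>
    \<Gamma> \<turnstile> e \<Colon> Coprod s A B \<Longrightarrow>
    \<Gamma> \<turnstile> CoprodElim s C c d e \<Colon> inst C e"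
| coprod_beta1: "\<Gamma> \<turnstile> A \<Colon> Univ s i \<Longrightarrow> \<Gamma> \<turnstile> B \<Colon> Univ s i \<Longrightarrow> Coprod s A B # \<Gamma> \<turnstile> C \<Colon> Univ s j \<Longrightarrow>
    A # \<Gamma> \<turnstile> c \<Colon> subst (InL s (Var 0) \<cdot> shift 1) C \<Longrightarrow>
    B # \<Gamma> \<turnstile> d \<Colon> subst (InR s (Var 0) \<cdot> shift 1) C \<Longrightarrow>
    \<Gamma> \<turnstile> a \<Colon> A \<Longrightarrow>
    \<Gamma> \<turnstile> CoprodElim s C c d (InL s a) \<doteq> inst c a \<Colon> inst C (InL s a)"
| coprod_beta2: "\<Gamma> \<turnstile> A \<Colon> Univ s i \<Longrightarrow> \<Gamma> \<turnstile> B \<Colon> Univ s i \<Longrightarrow> Coprod s A B # \<Gamma> \<turnstile> C \<Colon> Univ s j \<Longrightarrow>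
    A # \<Gamma> \<turnstile> c \<Colon> subst (InL s (Var 0) \<cdot> shift 1) C \<Longrightarrow>
    B # \<Gamma> \<turnstile> d \<Colon> subst (InR s (Var 0) \<cdot> shift 1) C \<Longrightarrow>
    \<Gamma> \<turnstile> b \<Colon> B \<Longrightarrow>
    \<Gamma> \<turnstile> CoprodElim s C c d (InR s b) \<doteq> inst d b \<Colon> inst C (InR s b)"
| eq_coprod: "\<Gamma> \<turnstile> A \<doteq> A' \<Colon> Univ s i \<Longrightarrow> \<Gamma> \<turnstile> B \<doteq> B' \<Colon> Univ s i \<Longrightarrow>
    \<Gamma> \<turnstile> Coprod s A B \<doteq> Coprod s A' B' \<Colon> Univ s i"
| eq_inl: "\<Gamma> \<turnstile> A \<Colon> Univ s i \<Longrightarrow> \<Gamma> \<turnstile> B \<Colon> Univ s i \<Longrightarrow> \<Gamma> \<turnstile> a \<doteq> a' \<Colon> A \<Longrightarrow>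
    \<Gamma> \<turnstile> InL s a \<doteq> InL s a' \<Colon> Coprod s A B"
| eq_inr: "\<Gamma> \<turnstile> A \<Colon> Univ s i \<Longrightarrow> \<Gamma> \<turnstile> B \<Colon> Univ s i \<Longrightarrow> \<Gamma> \<turnstile> b \<doteq> b' \<Colon> B \<Longrightarrow>
    \<Gamma> \<turnstile> InR s b \<doteq> InR s b' \<Colon> Coprod s A B"
| eq_coprod_elim: "Coprod s A B # \<Gamma> \<turnstile> C \<doteq> C' \<Colon> Univ s j \<Longrightarrow>
    A # \<Gamma> \<turnstile> c \<doteq> c' \<Colon> subst (InL s (Var 0) \<cdot> shift 1) C \<Longrightarrow>
    B # \<Gamma> \<turnstile> d \<doteq> d' \<Colon> subst (InR s (Var 0) \<cdot> shift 1) C \<Longrightarrow>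
    \<Gamma> \<turnstile> e \<doteq> e' \<Colon> Coprod s A B \<Longrightarrow>
    \<Gamma> \<turnstile> CoprodElim s C c d e \<doteq> CoprodElim s C' c' d' e' \<Colon> inst C e"

  \<comment> \<open>unit\<close>
| one_form: "ctx \<Gamma> \<Longrightarrow> \<Gamma> \<turnstile> One s \<Colon> Univ s i"
| one_intro: "ctx \<Gamma> \<Longrightarrow> \<Gamma> \<turnstile> Star s \<Colon> One s"
| one_elim: "One s # \<Gamma> \<turnstile> C \<Colon> Univ s j \<Longrightarrow> \<Gamma> \<turnstile> c \<Colon> inst C (Star s) \<Longrightarrow> \<Gamma> \<turnstile> a \<Colon> One s \<Longrightarrow>
    \<Gamma> \<turnstile> OneElim s C c a \<Colon> inst C a"
| one_beta: "One s # \<Gamma> \<turnstile> C \<Colon> Univ s j \<Longrightarrow> \<Gamma> \<turnstile> c \<Colon> inst C (Star s) \<Longrightarrow>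
    \<Gamma> \<turnstile> OneElim s C c (Star s) \<doteq> c \<Colon> inst C (Star s)"
| eq_one_elim: "One s # \<Gamma> \<turnstile> C \<doteq> C' \<Colon> Univ s j \<Longrightarrow> \<Gamma> \<turnstile> c \<doteq> c' \<Colon> inst C (Star s) \<Longrightarrow>
    \<Gamma> \<turnstile> a \<doteq> a' \<Colon> One s \<Longrightarrow>
    \<Gamma> \<turnstile> OneElim s C c a \<doteq> OneElim s C' c' a' \<Colon> inst C a"

  \<comment> \<open>empty type\<close>
| void_form: "ctx \<Gamma> \<Longrightarrow> \<Gamma> \<turnstile> Void s \<Colon> Univ s i"
| void_elim: "Void s # \<Gamma> \<turnstile> C \<Colon> Univ s j \<Longrightarrow> \<Gamma> \<turnstile> a \<Colon> Void s \<Longrightarrow> \<Gamma> \<turnstile> VoidElim s C a \<Colon> inst C a"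
| eq_void_elim: "Void s # \<Gamma> \<turnstile> C \<doteq> C' \<Colon> Univ s j \<Longrightarrow> \<Gamma> \<turnstile> a \<doteq> a' \<Colon> Void s \<Longrightarrow>
    \<Gamma> \<turnstile> VoidElim s C a \<doteq> VoidElim s C' a' \<Colon> inst C a"

  \<comment> \<open>natural numbers\<close>
| nat_form: "ctx \<Gamma> \<Longrightarrow> \<Gamma> \<turnstile> NatTy s \<Colon> Univ s i"
| nat_intro1: "ctx \<Gamma> \<Longrightarrow> \<Gamma> \<turnstile> Zero s \<Colon> NatTy s"
| nat_intro2: "\<Gamma> \<turnstile> n \<Colon> NatTy s \<Longrightarrow> \<Gamma> \<turnstile> Succ s n \<Colon> NatTy s"
| nat_elim: "NatTy s # \<Gamma> \<turnstile> C \<Colon> Univ s j \<Longrightarrow> \<Gamma> \<turnstile> z \<Colon> inst C (Zero s) \<Longrightarrow>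
    C # NatTy s # \<Gamma> \<turnstile> c \<Colon> subst (Succ s (Var 1) \<cdot> shift 2) C \<Longrightarrow>
    \<Gamma> \<turnstile> n \<Colon> NatTy s \<Longrightarrow>
    \<Gamma> \<turnstile> NatElim s C z c n \<Colon> inst C n"
| nat_beta1: "NatTy s # \<Gamma> \<turnstile> C \<Colon> Univ s j \<Longrightarrow> \<Gamma> \<turnstile> z \<Colon> inst C (Zero s) \<Longrightarrow>
    C # NatTy s # \<Gamma> \<turnstile> c \<Colon> subst (Succ s (Var 1) \<cdot> shift 2) C \<Longrightarrow>
    \<Gamma> \<turnstile> NatElim s C z c (Zero s) \<doteq> z \<Colon> inst C (Zero s)"
| nat_beta2: "NatTy s # \<Gamma> \<turnstile> C \<Colon> Univ s j \<Longrightarrow> \<Gamma> \<turnstile> z \<Colon> inst C (Zero s) \<Longrightarrow>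
    C # NatTy s # \<Gamma> \<turnstile> c \<Colon> subst (Succ s (Var 1) \<cdot> shift 2) C \<Longrightarrow>
    \<Gamma> \<turnstile> n \<Colon> NatTy s \<Longrightarrow>
    \<Gamma> \<turnstile> NatElim s C z c (Succ s n) \<doteq> subst (NatElim s C z c n \<cdot> n \<cdot> Var) c \<Colon> inst C (Succ s n)"
| eq_succ: "\<Gamma> \<turnstile> n \<doteq> n' \<Colon> NatTy s \<Longrightarrow> \<Gamma> \<turnstile> Succ s n \<doteq> Succ s n' \<Colon> NatTy s"
| eq_nat_elim: "NatTy s # \<Gamma> \<turnstile> C \<doteq> C' \<Colon> Univ s j \<Longrightarrow> \<Gamma> \<turnstile> z \<doteq> z' \<Colon> inst C (Zero s) \<Longrightarrow>
    C # NatTy s # \<Gamma> \<turnstile> c \<doteq> c' \<Colon> subst (Succ s (Var 1) \<cdot> shift 2) C \<Longrightarrow>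
    \<Gamma> \<turnstile> n \<doteq> n' \<Colon> NatTy s \<Longrightarrow>
    \<Gamma> \<turnstile> NatElim s C z c n \<doteq> NatElim s C' z' c' n' \<Colon> inst C n"

  \<comment> \<open>identity types (layer \<open>Inn\<close>) and exo-equality (layer \<open>Exo\<close>)\<close>
| id_form: "\<Gamma> \<turnstile> A \<Colon> Univ s i \<Longrightarrow> \<Gamma> \<turnstile> a \<Colon> A \<Longrightarrow> \<Gamma> \<turnstile> b \<Colon> A \<Longrightarrow> \<Gamma> \<turnstile> Eq s A a b \<Colon> Univ s i"
| id_intro: "\<Gamma> \<turnstile> A \<Colon> Univ s i \<Longrightarrow> \<Gamma> \<turnstile> a \<Colon> A \<Longrightarrow> \<Gamma> \<turnstile> Refl s a \<Colon> Eq s A a a"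
| id_elim: "Eq s (lift (lift A)) (Var 1) (Var 0) # lift A # A # \<Gamma> \<turnstile> C \<Colon> Univ s j \<Longrightarrow>
    A # \<Gamma> \<turnstile> c \<Colon> subst (Refl s (Var 0) \<cdot> Var 0 \<cdot> Var 0 \<cdot> shift 1) C \<Longrightarrow>
    \<Gamma> \<turnstile> a \<Colon> A \<Longrightarrow> \<Gamma> \<turnstile> b \<Colon> A \<Longrightarrow> \<Gamma> \<turnstile> p \<Colon> Eq s A a b \<Longrightarrow>
    \<Gamma> \<turnstile> EqElim s C c a b p \<Colon> subst (p \<cdot> b \<cdot> a \<cdot> Var) C"
| id_beta: "\<Gamma> \<turnstile> A \<Colon> Univ s i \<Longrightarrow>
    Eq s (lift (lift A)) (Var 1) (Var 0) # lift A # A # \<Gamma> \<turnstile> C \<Colon> Univ s j \<Longrightarrow>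
    A # \<Gamma> \<turnstile> c \<Colon> subst (Refl s (Var 0) \<cdot> Var 0 \<cdot> Var 0 \<cdot> shift 1) C \<Longrightarrow>
    \<Gamma> \<turnstile> a \<Colon> A \<Longrightarrow>
    \<Gamma> \<turnstile> EqElim s C c a a (Refl s a) \<doteq> inst c a \<Colon> subst (Refl s a \<cdot> a \<cdot> a \<cdot> Var) C"
| eq_id: "\<Gamma> \<turnstile> A \<doteq> A' \<Colon> Univ s i \<Longrightarrow> \<Gamma> \<turnstile> a \<doteq> a' \<Colon> A \<Longrightarrow> \<Gamma> \<turnstile> b \<doteq> b' \<Colon> A \<Longrightarrow>
    \<Gamma> \<turnstile> Eq s A a b \<doteq> Eq s A' a' b' \<Colon> Univ s i"
| eq_id_intro: "\<Gamma> \<turnstile> A \<Colon> Univ s i \<Longrightarrow> \<Gamma> \<turnstile> a \<doteq> a' \<Colon> A \<Longrightarrow> \<Gamma> \<turnstile> Refl s a \<doteq> Refl s a' \<Colon> Eq s A a a"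
| eq_id_elim: "Eq s (lift (lift A)) (Var 1) (Var 0) # lift A # A # \<Gamma> \<turnstile> C \<doteq> C' \<Colon> Univ s j \<Longrightarrow>
    A # \<Gamma> \<turnstile> c \<doteq> c' \<Colon> subst (Refl s (Var 0) \<cdot> Var 0 \<cdot> Var 0 \<cdot> shift 1) C \<Longrightarrow>
    \<Gamma> \<turnstile> a \<doteq> a' \<Colon> A \<Longrightarrow> \<Gamma> \<turnstile> b \<doteq> b' \<Colon> A \<Longrightarrow> \<Gamma> \<turnstile> p \<doteq> p' \<Colon> Eq s A a b \<Longrightarrow>
    \<Gamma> \<turnstile> EqElim s C c a b p \<doteq> EqElim s C' c' a' b' p' \<Colon> subst (p \<cdot> b \<cdot> a \<cdot> Var) C"

section \<open>Fibrancy and cofibrancy\<close>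

definition exo_iso :: "tm \<Rightarrow> tm \<Rightarrow> tm" where
  "exo_iso A B =
     Sig Exo (arr Exo A B)
       (Sig Exo (arr Exo (lift B) (lift A))
         (let A' = lift (lift A); B' = lift (lift B); f = Var 1; g = Var 0 in
            times Exo (Eq Exo (arr Exo B' B') (comp Exo B' f g) (idfun Exo B'))
                      (Eq Exo (arr Exo A' A') (comp Exo A' g f) (idfun Exo A'))))"

text \<open>\<open>fibrant k A\<close>: there is a type \<open>RA : U_k\<close> with \<open>A \<cong> RA\<close>.\<close>

definition fibrant :: "nat \<Rightarrow> tm \<Rightarrow> tm" where
  "fibrant k A = Sig Exo (Univ Inn k) (exo_iso (lift A) (Var 0))"

definition families :: "nat \<Rightarrow> tm \<Rightarrow> tm" where
  "families i A = arr Exo A (Univ Inn i)"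

definition pi_fibrant :: "nat \<Rightarrow> nat \<Rightarrow> tm \<Rightarrow> tm" where
  "pi_fibrant i k A = Pi Exo (families i A) (fibrant k (pi_exo (lift A) (Var 0)))"

text \<open>
  For \<open>H : pi_fibrant i k A\<close> and \<open>Y : families i A\<close>, the fibrant match \<open>FM_Y\<close> of \<open>pi_exo A Y\<close> provided
  by \<open>H\<close>, and the map \<open>r_Y\<close> of the accompanying exo-isomorphism (the inverse \<open>s_Y\<close> and the
  two exo-equalities are the remaining components of \<open>H Y\<close>).
\<close>

definition fmatch :: "nat \<Rightarrow> tm \<Rightarrow> tm \<Rightarrow> tm" where
  "fmatch k H Y = proj1 Exo (Univ Inn k) (App Exo H Y)"

definition fmatch_map :: "nat \<Rightarrow> tm \<Rightarrow> tm \<Rightarrow> tm \<Rightarrow> tm" where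
  "fmatch_map k A H Y =
     proj1 Exo (arr Exo (pi_exo A Y) (fmatch k H Y))
       (proj2 Exo (Univ Inn k) (exo_iso (lift (pi_exo A Y)) (Var 0)) (App Exo H Y))"

definition contr_preserving :: "nat \<Rightarrow> nat \<Rightarrow> tm \<Rightarrow> tm \<Rightarrow> tm" where
  "contr_preserving i k A H =
     Pi Exo (families i A)
       (arr Exo (Pi Exo (lift A) (is_contr (App Exo (Var 1) (Var 0))))
                (is_contr (fmatch k (lift H) (Var 0))))"

text \<open>
  An exo-type is cofibrant (for families in \<open>U_i\<close> with fibrant matches in \<open>U_k\<close>) if it has both
  properties; the second one refers to the fibrant matches provided by the first.
\<close>

definition cofibrant :: "nat \<Rightarrow> nat \<Rightarrow> tm \<Rightarrow> tm" where
  "cofibrant i k A = Sig Exo (pi_fibrant i k A) (contr_preserving i k (lift A) (Var 0))"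

text \<open>The binders are \<open>Y\<close>, \<open>f\<close>, \<open>g\<close> and, in the premise of the arrow, \<open>a\<close>.\<close>

definition cofibrant_funext :: "nat \<Rightarrow> nat \<Rightarrow> tm \<Rightarrow> tm \<Rightarrow> tm" where
  "cofibrant_funext i k A H =
     (let A1 = lift A; A2 = lift A1; A3 = lift A2; H3 = lift (lift (lift H)) in
      Pi Exo (families i A) (Pi Exo (pi_exo A1 (Var 0)) (Pi Exo (pi_exo A2 (Var 1))
        (arr Exo
           (Pi Exo A3
              (Eq Inn (App Exo (Var 3) (Var 0)) (App Exo (Var 2) (Var 0)) (App Exo (Var 1) (Var 0))))
           (Eq Inn (fmatch k H3 (Var 2))
              (App Exo (fmatch_map k A3 H3 (Var 2)) (Var 1))
              (App Exo (fmatch_map k A3 H3 (Var 2)) (Var 0)))))))"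

definition exo_iff :: "tm \<Rightarrow> tm \<Rightarrow> tm" where
  "exo_iff P Q = times Exo (arr Exo P Q) (arr Exo Q P)"

end

theory Submission
  imports Defs
begin

text \<open>
  Judgements are stable under well-typed substitution, so that the argument can be carried out
  with terms in arbitrary contexts.

  From contractibility to function extensionality: given a homotopy between \<open>f\<close> and \<open>g\<close>, the family
  of singletons \<open>Y' a = \<Sum> y : Y a. f a = y\<close> is fibrewise contractible, hence \<open>FM_Y'\<close> is contractible. Both \<open>f\<close>
  (with reflexivity) and \<open>g\<close> (with the homotopy) lift to sections \<open>u\<close>, \<open>v\<close> of \<open>Y'\<close>, and \<open>r_Y'(u)\<close>, \<open>r_Y'(v)\<close>
  are identified. Applying \<open>x \<mapsto> r_Y (\<lambda>a. fst (s_Y' x a))\<close> and transporting along the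
  exo-equality \<open>s_Y' \<circ> r_Y' = id\<close> gives \<open>r_Y f = r_Y g\<close>.

  Conversely, if every \<open>Y a\<close> is contractible, then \<open>r_Y\<close> of the section of centers is a center of \<open>FM_Y\<close>:
  that section is homotopic to \<open>s_Y x\<close> for each \<open>x : FM_Y\<close>, and \<open>r_Y (s_Y x)\<close> is exo-equal to \<open>x\<close>.
\<close>

section \<open>Substitution calculus\<close>

text \<open>The exo-product of \<open>Y\<close> is in general not a type, so it carries no inner
  identity type into which the identities \<open>f a = g a\<close> could be assembled; identity only
  becomes available in FM_Y. The singleton family replaces this assembly by a contraction inside the
  one type FM_Y'. The map from FM_Y' to FM_Y is only an exo-function, but it runs between types. The
  identities in FM_Y formed with it are therefore types, and inner identity elimination accepts them
  as a motive. The law that s_Y' after r_Y' is the identity is an exo-equality of functions, not a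
  conversion, and there is no reflection rule. It has to be eliminated at the exo-level, where a
  motive may be any exo-type, in particular a family of inner identity types. The first projections
  of the two lifted sections, by contrast, are convertible to \<open>f\<close> and \<open>g\<close>
  through beta and eta, so the last step is a mere change of type.\<close>

declare ren.simps [simp del]

definition scomp :: "(nat \<Rightarrow> tm) \<Rightarrow> (nat \<Rightarrow> tm) \<Rightarrow> nat \<Rightarrow> tm" (infixl "\<odot>" 70) where
  "\<sigma> \<odot> \<tau> = (\<lambda>n. subst \<tau> (\<sigma> n))"

lemma scons_simps [simp]:
  "(a \<cdot> \<sigma>) 0 = a"
  "(a \<cdot> \<sigma>) (Suc n) = \<sigma> n"
  "(a \<cdot> \<sigma>) (numeral m) = \<sigma> (pred_numeral m)"
  by (simp_all add: scons_def numeral_eq_Suc)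

lemma up_simps [simp]:
  "up \<sigma> 0 = Var 0"
  "up \<sigma> (Suc n) = lift (\<sigma> n)"
  by (simp_all add: up_def)

lemma up_ren_simps [simp]:
  "up_ren r 0 = 0"
  "up_ren r (Suc n) = Suc (r n)"
  by (simp_all add: up_ren_def)

lemma fun_eq_nat_cases: "f 0 = g 0 \<Longrightarrow> (\<And>n. f (Suc n) = g (Suc n)) \<Longrightarrow> f = g"
  by (rule ext) (metis not0_implies_Suc)

lemma up_Var_ren: "up (\<lambda>n. Var (r n)) = (\<lambda>n. Var (up_ren r n))"
  by (rule fun_eq_nat_cases) (simp_all add: ren.simps)

text \<open>With \<open>ren.simps\<close> removed from the simplifier, lifting can be treated as
  substitution by a shift instead of being pushed into terms.\<close>

lemma ren_conv_subst: "ren r t = subst (\<lambda>n. Var (r n)) t"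
  by (induction t arbitrary: r) (simp_all add: ren.simps up_Var_ren)

lemma up_comp_ren: "(\<lambda>n. up \<tau> (up_ren r n)) = up (\<lambda>n. \<tau> (r n))"
  by (rule fun_eq_nat_cases) simp_all

lemma subst_ren: "subst \<tau> (ren r t) = subst (\<lambda>n. \<tau> (r n)) t"
  by (induction t arbitrary: \<tau> r) (simp_all add: ren.simps up_comp_ren)

lemma ren_ren: "ren q (ren r t) = ren (\<lambda>n. q (r n)) t"
  by (simp add: ren_conv_subst [of q] subst_ren) (simp add: ren_conv_subst)

lemma ren_up_comp: "(\<lambda>n. ren (up_ren r) (up \<tau> n)) = up (\<lambda>n. ren r (\<tau> n))"
  by (rule fun_eq_nat_cases) (simp_all add: ren.simps ren_ren)

lemma ren_subst: "ren r (subst \<tau> t) = subst (\<lambda>n. ren r (\<tau> n)) t"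
  by (induction t arbitrary: \<tau> r) (simp_all add: ren.simps ren_up_comp)

text \<open>At a successor a lift has to pass through a substitution on either side. Hence the mixed
  laws \<open>subst_ren\<close> and \<open>ren_subst\<close> come before the composition of two
  substitutions.\<close>

lemma up_scomp: "up \<sigma> \<odot> up \<tau> = up (\<sigma> \<odot> \<tau>)"
  by (rule fun_eq_nat_cases) (simp_all add: scomp_def ren_subst subst_ren)

lemma subst_subst [simp]: "subst \<tau> (subst \<sigma> t) = subst (\<sigma> \<odot> \<tau>) t"
proof (induction t arbitrary: \<sigma> \<tau>)
  case (Var n)
  then show ?case by (simp add: scomp_def)
qed (simp_all add: up_scomp)

lemma up_Var: "up Var = Var"
  by (rule fun_eq_nat_cases) (simp_all add: ren.simps)

lemma subst_Var [simp]: "subst Var t = t"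
  by (induction t) (simp_all add: up_Var)

text \<open>Composition is normalised to the right, so that shifts meet the substitutions they cancel.\<close>

lemma scomp_simps [simp]:
  "(\<sigma> \<odot> \<tau>) n = subst \<tau> (\<sigma> n)"
  "Var \<odot> \<sigma> = \<sigma>"
  "\<sigma> \<odot> Var = \<sigma>"
  "(\<sigma> \<odot> \<tau>) \<odot> \<upsilon> = \<sigma> \<odot> (\<tau> \<odot> \<upsilon>)"
  by (simp_all add: scomp_def fun_eq_iff)

lemma scons_scomp [simp]: "(a \<cdot> \<sigma>) \<odot> \<tau> = subst \<tau> a \<cdot> (\<sigma> \<odot> \<tau>)"
  by (rule fun_eq_nat_cases) (simp_all add: scomp_def)

lemma shift_simps [simp]:
  "shift 0 = Var"
  "shift k n = Var (n + k)"
  "shift (Suc k) \<odot> (a \<cdot> \<sigma>) = shift k \<odot> \<sigma>"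
  "shift k \<odot> shift l = shift (k + l)"
  "shift k \<odot> (shift l \<odot> \<sigma>) = shift (k + l) \<odot> \<sigma>"
  "Var 0 \<cdot> shift (Suc 0) = Var"
  "Var k \<cdot> shift (Suc k) = shift k"
  by (simp_all add: shift_def scomp_def scons_def fun_eq_iff numeral_eq_Suc ac_simps
      split: nat.split)

lemma lift_conv_subst: "lift t = subst (shift (Suc 0)) t"
  by (simp add: ren_conv_subst shift_def)

lemma ren_add_conv_subst: "ren (\<lambda>m. m + k) t = subst (shift k) t"
  by (simp add: ren_conv_subst shift_def)

lemma up_conv_scons: "up \<sigma> = Var 0 \<cdot> (\<sigma> \<odot> shift (Suc 0))"
  by (rule fun_eq_nat_cases) (simp_all add: lift_conv_subst)

text \<open>Reduces \<open>lift\<close> and \<open>up\<close> to cons and shift, so that equations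
  between substituted terms are settled by normalisation. Numerals become successors to let
  \<open>shift (Suc k)\<close> cancel against a cons.\<close>

lemmas sigma_simps = lift_conv_subst ren_add_conv_subst up_conv_scons numeral_2_eq_2 numeral_3_eq_3

section \<open>Stability of the judgements under substitution\<close>

text \<open>These are the shapes of substitution occurring in the typing rules: instantiated
  motives, and motives at a constructor in the branches. Moving \<sigma> inside them brings a
  substituted premise back to the form that the rule expects.\<close>

lemma subst_inst: "subst \<sigma> (inst t a) = inst (subst (up \<sigma>) t) (subst \<sigma> a)"
  and subst_inst2:
    "subst \<sigma> (subst (b \<cdot> a \<cdot> Var) t) = subst (subst \<sigma> b \<cdot> subst \<sigma> a \<cdot> Var) (subst (up (up \<sigma>)) t)"
  and subst_inst3:
    "subst \<sigma> (subst (c \<cdot> b \<cdot> a \<cdot> Var) t) =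
     subst (subst \<sigma> c \<cdot> subst \<sigma> b \<cdot> subst \<sigma> a \<cdot> Var) (subst (up (up (up \<sigma>))) t)"
  and subst_lift: "subst (up \<sigma>) (lift t) = lift (subst \<sigma> t)"
  and subst_branch1:
    "subst (up \<sigma>) (subst (u \<cdot> shift 1) t) = subst (subst (up \<sigma>) u \<cdot> shift 1) (subst (up \<sigma>) t)"
  and subst_branch2:
    "subst (up (up \<sigma>)) (subst (u \<cdot> shift 2) t) =
     subst (subst (up (up \<sigma>)) u \<cdot> shift 2) (subst (up \<sigma>) t)"
  and subst_branch3:
    "subst (up \<sigma>) (subst (c \<cdot> b \<cdot> a \<cdot> shift 1) t) =
     subst (subst (up \<sigma>) c \<cdot> subst (up \<sigma>) b \<cdot> subst (up \<sigma>) a \<cdot> shift 1) (subst (up (up (up \<sigma>))) t)"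
  by (simp_all add: sigma_simps)

lemma up_numerals: "up \<sigma> 1 = lift (\<sigma> 0)" "lift (Var n) = Var (Suc n)"
  by (simp_all add: sigma_simps)

lemmas subst_push = subst.simps subst_inst subst_inst2 subst_inst3 subst_lift
  subst_branch1 subst_branch2 subst_branch3 up_simps up_numerals One_nat_def [symmetric]

lemma subst_const_type: "subst \<sigma> (const_type c) = const_type c"
  by (cases c) (simp_all add: sigma_simps is_equiv_def equiv_def id_to_equiv_def id_equiv_def
      times_def arr_def idfun_def pi_exo_def)

text \<open>
  The class \<open>S\<close> of substitutions is left open because closure of all well-typed substitutions under
  binders presupposes weakening, that is, stability under renamings.
\<close>

locale subst_class =
  fixes S :: "tm list \<Rightarrow> (nat \<Rightarrow> tm) \<Rightarrow> tm list \<Rightarrow> bool"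
  assumes ctx_target: "S \<Delta> \<sigma> \<Gamma> \<Longrightarrow> ctx \<Delta>"
    and typing_image: "S \<Delta> \<sigma> \<Gamma> \<Longrightarrow> n < length \<Gamma> \<Longrightarrow> \<Delta> \<turnstile> \<sigma> n \<Colon> subst (shift (Suc n) \<odot> \<sigma>) (\<Gamma> ! n)"
    and up_closed: "S \<Delta> \<sigma> \<Gamma> \<Longrightarrow> \<Delta> \<turnstile> subst \<sigma> A \<Colon> Univ s i \<Longrightarrow> S (subst \<sigma> A # \<Delta>) (up \<sigma>) (A # \<Gamma>)"
begin

text \<open>
  Some rules extend the context by a type whose well-formedness is not among their premises, for
  instance \<open>sig_elim\<close> by \<open>Sig s A B\<close>; stability of that type is therefore recorded with the context.
\<close>

fun ctx_stable :: "tm list \<Rightarrow> bool" where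
  "ctx_stable [] = True"
| "ctx_stable (A # \<Gamma>) =
     (ctx_stable \<Gamma> \<and> (\<exists>s i. \<forall>\<Delta> \<sigma>. S \<Delta> \<sigma> \<Gamma> \<longrightarrow> \<Delta> \<turnstile> subst \<sigma> A \<Colon> Univ s i))"

definition typing_stable :: "tm list \<Rightarrow> tm \<Rightarrow> tm \<Rightarrow> bool" where
  "typing_stable \<Gamma> t A \<longleftrightarrow>
     ctx_stable \<Gamma> \<and> (\<forall>\<Delta> \<sigma>. S \<Delta> \<sigma> \<Gamma> \<longrightarrow> \<Delta> \<turnstile> subst \<sigma> t \<Colon> subst \<sigma> A)"

definition conv_stable :: "tm list \<Rightarrow> tm \<Rightarrow> tm \<Rightarrow> tm \<Rightarrow> bool" where
  "conv_stable \<Gamma> t u A \<longleftrightarrow>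
     ctx_stable \<Gamma> \<and> (\<forall>\<Delta> \<sigma>. S \<Delta> \<sigma> \<Gamma> \<longrightarrow> \<Delta> \<turnstile> subst \<sigma> t \<doteq> subst \<sigma> u \<Colon> subst \<sigma> A)"

lemma up_stable: "ctx_stable (A # \<Gamma>) \<Longrightarrow> S \<Delta> \<sigma> \<Gamma> \<Longrightarrow> S (subst \<sigma> A # \<Delta>) (up \<sigma>) (A # \<Gamma>)"
  by (metis ctx_stable.simps(2) up_closed)

lemma ctx_stableD:
  "ctx_stable (A # \<Gamma>) \<Longrightarrow> ctx_stable \<Gamma>"
  "typing_stable \<Gamma> t A \<Longrightarrow> ctx_stable \<Gamma>"
  "conv_stable \<Gamma> t u A \<Longrightarrow> ctx_stable \<Gamma>"
  by (simp_all add: typing_stable_def conv_stable_def)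

lemma typing_stableD:
  "typing_stable \<Gamma> t T \<Longrightarrow> S \<Delta> \<sigma> \<Gamma> \<Longrightarrow> \<Delta> \<turnstile> subst \<sigma> t \<Colon> subst \<sigma> T"
  "typing_stable (A # \<Gamma>) t T \<Longrightarrow> S \<Delta> \<sigma> \<Gamma> \<Longrightarrow> subst \<sigma> A # \<Delta> \<turnstile> subst (up \<sigma>) t \<Colon> subst (up \<sigma>) T"
  "typing_stable (B # A # \<Gamma>) t T \<Longrightarrow> S \<Delta> \<sigma> \<Gamma> \<Longrightarrow>
     subst (up \<sigma>) B # subst \<sigma> A # \<Delta> \<turnstile> subst (up (up \<sigma>)) t \<Colon> subst (up (up \<sigma>)) T"
  "typing_stable (C # B # A # \<Gamma>) t T \<Longrightarrow> S \<Delta> \<sigma> \<Gamma> \<Longrightarrow>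
     subst (up (up \<sigma>)) C # subst (up \<sigma>) B # subst \<sigma> A # \<Delta>
       \<turnstile> subst (up (up (up \<sigma>))) t \<Colon> subst (up (up (up \<sigma>))) T"
  unfolding typing_stable_def by (blast dest: up_stable ctx_stableD(1))+

lemma conv_stableD:
  "conv_stable \<Gamma> t u T \<Longrightarrow> S \<Delta> \<sigma> \<Gamma> \<Longrightarrow> \<Delta> \<turnstile> subst \<sigma> t \<doteq> subst \<sigma> u \<Colon> subst \<sigma> T"
  "conv_stable (A # \<Gamma>) t u T \<Longrightarrow> S \<Delta> \<sigma> \<Gamma> \<Longrightarrow>
     subst \<sigma> A # \<Delta> \<turnstile> subst (up \<sigma>) t \<doteq> subst (up \<sigma>) u \<Colon> subst (up \<sigma>) T"
  "conv_stable (B # A # \<Gamma>) t u T \<Longrightarrow> S \<Delta> \<sigma> \<Gamma> \<Longrightarrow>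
     subst (up \<sigma>) B # subst \<sigma> A # \<Delta> \<turnstile> subst (up (up \<sigma>)) t \<doteq> subst (up (up \<sigma>)) u
       \<Colon> subst (up (up \<sigma>)) T"
  "conv_stable (C # B # A # \<Gamma>) t u T \<Longrightarrow> S \<Delta> \<sigma> \<Gamma> \<Longrightarrow>
     subst (up (up \<sigma>)) C # subst (up \<sigma>) B # subst \<sigma> A # \<Delta>
       \<turnstile> subst (up (up (up \<sigma>))) t \<doteq> subst (up (up (up \<sigma>))) u \<Colon> subst (up (up (up \<sigma>))) T"
  unfolding conv_stable_def by (blast dest: up_stable ctx_stableD(1))+

lemma typing_stableI:
  "ctx_stable \<Gamma> \<Longrightarrow> (\<And>\<Delta> \<sigma>. S \<Delta> \<sigma> \<Gamma> \<Longrightarrow> \<Delta> \<turnstile> subst \<sigma> t \<Colon> subst \<sigma> A) \<Longrightarrow> typing_stable \<Gamma> t A"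
  by (simp add: typing_stable_def)

lemma conv_stableI:
  "ctx_stable \<Gamma> \<Longrightarrow> (\<And>\<Delta> \<sigma>. S \<Delta> \<sigma> \<Gamma> \<Longrightarrow> \<Delta> \<turnstile> subst \<sigma> t \<doteq> subst \<sigma> u \<Colon> subst \<sigma> A) \<Longrightarrow>
   conv_stable \<Gamma> t u A"
  by (simp add: conv_stable_def)

lemmas stableD = typing_stableD conv_stableD

lemma stability:
  shows "ctx \<Gamma> \<Longrightarrow> ctx_stable \<Gamma>"
    and "\<Gamma> \<turnstile> t \<Colon> A \<Longrightarrow> typing_stable \<Gamma> t A"
    and "\<Gamma> \<turnstile> t \<doteq> u \<Colon> A \<Longrightarrow> conv_stable \<Gamma> t u A"
proof (induction rule: ctx_typing_conv.inducts)
  case ctx_nil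
  show ?case by simp
next
  case (ctx_cons \<Gamma> A s i)
  then show ?case by (auto simp: typing_stable_def)
next
  case (var \<Gamma> n)
  then show ?case
    by (auto intro!: typing_stableI typing_image simp: ren_add_conv_subst simp del: add_Suc_right)
next
  case (const \<Gamma> c)
  then show ?case by (auto intro!: typing_stableI ctx_typing_conv.const simp: subst_const_type dest: ctx_target)
\<comment> \<open>All other rules follow one pattern: the induction hypotheses are instantiated at
  the substitution and at its lifts under up to three binders, the substitution is pushed through
  the types, and the same rule is applied again.\<close>
qed ((rule typing_stableI conv_stableI, blast dest: ctx_stableD,
    ((drule (1) stableD)+)?, (drule ctx_target)?, (simp (no_asm_use) only: subst_push)?,
    rule ctx_typing_conv.intros; assumption)+)

end

section \<open>Stability under renamings, weakening, stability under substitutions\<close>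

lemma typing_imp_ctx:
  shows "ctx \<Gamma> \<Longrightarrow> True"
    and "\<Gamma> \<turnstile> t \<Colon> A \<Longrightarrow> ctx \<Gamma>"
    and "\<Gamma> \<turnstile> t \<doteq> u \<Colon> A \<Longrightarrow> ctx \<Gamma>"
  by (induction rule: ctx_typing_conv.inducts) (blast | fast)+

text \<open>The types of variables are compared as raw terms and not by a judgement; closure under
  binders can then be checked before weakening is known.\<close>

definition renaming :: "tm list \<Rightarrow> (nat \<Rightarrow> tm) \<Rightarrow> tm list \<Rightarrow> bool" where
  "renaming \<Delta> \<sigma> \<Gamma> \<longleftrightarrow> ctx \<Delta> \<and> (\<exists>r. \<sigma> = (\<lambda>n. Var (r n)) \<and>
     (\<forall>n<length \<Gamma>. r n < length \<Delta> \<and>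
        subst (shift (Suc (r n))) (\<Delta> ! r n) = subst (shift (Suc n) \<odot> \<sigma>) (\<Gamma> ! n)))"

definition substitution :: "tm list \<Rightarrow> (nat \<Rightarrow> tm) \<Rightarrow> tm list \<Rightarrow> bool" where
  "substitution \<Delta> \<sigma> \<Gamma> \<longleftrightarrow> ctx \<Delta> \<and>
     (\<forall>n<length \<Gamma>. \<Delta> \<turnstile> \<sigma> n \<Colon> subst (shift (Suc n) \<odot> \<sigma>) (\<Gamma> ! n))"

lemma typing_Var: "ctx \<Gamma> \<Longrightarrow> n < length \<Gamma> \<Longrightarrow> \<Gamma> \<turnstile> Var n \<Colon> subst (shift (Suc n)) (\<Gamma> ! n)"
  using var[of \<Gamma> n] by (simp add: ren_add_conv_subst del: add_Suc_right)

interpretation renaming: subst_class renaming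
proof
  fix \<Delta> \<sigma> \<Gamma> A s i
  assume S: "renaming \<Delta> \<sigma> \<Gamma>"
  show "ctx \<Delta>"
    using S by (simp add: renaming_def)
  show "\<Delta> \<turnstile> \<sigma> n \<Colon> subst (shift (Suc n) \<odot> \<sigma>) (\<Gamma> ! n)" if "n < length \<Gamma>" for n
    using S that by (auto simp: renaming_def dest!: spec[of _ n] dest: typing_Var)
  assume A: "\<Delta> \<turnstile> subst \<sigma> A \<Colon> Univ s i"
  obtain r where r: "\<sigma> = (\<lambda>n. Var (r n))"
    and eq: "\<And>n. n < length \<Gamma> \<Longrightarrow> r n < length \<Delta> \<and>
      subst (shift (Suc (r n))) (\<Delta> ! r n) = subst (shift (Suc n) \<odot> \<sigma>) (\<Gamma> ! n)"
    using S unfolding renaming_def by blast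
  have "up_ren r n < length (subst \<sigma> A # \<Delta>) \<and>
      subst (shift (Suc (up_ren r n))) ((subst \<sigma> A # \<Delta>) ! up_ren r n) =
      subst (shift (Suc n) \<odot> up \<sigma>) ((A # \<Gamma>) ! n)" if n: "n < length (A # \<Gamma>)" for n
  proof (cases n)
    case 0
    then show ?thesis by (simp add: sigma_simps)
  next
    case (Suc m)
    then have "subst (shift (Suc 0)) (subst (shift (Suc (r m))) (\<Delta> ! r m)) =
        subst (shift (Suc 0)) (subst (shift (Suc m) \<odot> \<sigma>) (\<Gamma> ! m))"
      using eq n by simp
    then show ?thesis
      using eq n Suc by (simp add: sigma_simps)
  qed
  moreover have "up \<sigma> = (\<lambda>n. Var (up_ren r n))"
    by (simp add: r up_Var_ren)
  ultimately show "renaming (subst \<sigma> A # \<Delta>) (up \<sigma>) (A # \<Gamma>)"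
    using ctx_cons[OF A] unfolding renaming_def by blast
qed

lemma renaming_shift:
  assumes "ctx (A # \<Gamma>)"
  shows "renaming (A # \<Gamma>) (shift (Suc 0)) \<Gamma>"
  unfolding renaming_def
proof (intro conjI exI[of _ Suc] allI impI)
  show "shift (Suc 0) = (\<lambda>n. Var (Suc n))"
    by (simp add: shift_def)
qed (simp_all add: assms)

lemma weakening:
  assumes "\<Gamma> \<turnstile> t \<Colon> T" and "ctx (A # \<Gamma>)"
  shows "A # \<Gamma> \<turnstile> lift t \<Colon> lift T"
  using renaming.stability(2)[OF assms(1)] renaming_shift[OF assms(2)]
  by (simp add: renaming.typing_stable_def lift_conv_subst)

interpretation substitution: subst_class substitution
proof
  fix \<Delta> \<sigma> \<Gamma> A s i
  assume S: "substitution \<Delta> \<sigma> \<Gamma>"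
  show "ctx \<Delta>"
    using S by (simp add: substitution_def)
  show "\<Delta> \<turnstile> \<sigma> n \<Colon> subst (shift (Suc n) \<odot> \<sigma>) (\<Gamma> ! n)" if "n < length \<Gamma>" for n
    using S that by (simp add: substitution_def)
  assume A: "\<Delta> \<turnstile> subst \<sigma> A \<Colon> Univ s i"
  have "subst \<sigma> A # \<Delta> \<turnstile> up \<sigma> n \<Colon> subst (shift (Suc n) \<odot> up \<sigma>) ((A # \<Gamma>) ! n)"
    if n: "n < length (A # \<Gamma>)" for n
  proof (cases n)
    case 0
    then show ?thesis
      using typing_Var[OF ctx_cons[OF A], of 0] by (simp add: sigma_simps)
  next
    case (Suc m)
    then have "\<Delta> \<turnstile> \<sigma> m \<Colon> subst (shift (Suc m) \<odot> \<sigma>) (\<Gamma> ! m)"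
      using S n by (simp add: substitution_def)
    \<comment> \<open>Closure under binders rests on weakening, which the instance for renamings has
      supplied.\<close>
    from weakening[OF this ctx_cons[OF A]] show ?thesis
      using Suc by (simp add: sigma_simps)
  qed
  then show "substitution (subst \<sigma> A # \<Delta>) (up \<sigma>) (A # \<Gamma>)"
    using ctx_cons[OF A] by (simp add: substitution_def)
qed

lemma typing_subst: "\<Gamma> \<turnstile> t \<Colon> T \<Longrightarrow> substitution \<Delta> \<sigma> \<Gamma> \<Longrightarrow> \<Delta> \<turnstile> subst \<sigma> t \<Colon> subst \<sigma> T"
  using substitution.stability(2) by (simp add: substitution.typing_stable_def)

lemma substitution_Var: "ctx \<Gamma> \<Longrightarrow> substitution \<Gamma> Var \<Gamma>"
  by (simp add: substitution_def typing_Var)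

lemma substitution_shift_Suc:
  "substitution \<Gamma> (shift k) \<Delta> \<Longrightarrow> ctx (A # \<Gamma>) \<Longrightarrow> substitution (A # \<Gamma>) (shift (Suc k)) \<Delta>"
  unfolding substitution_def using weakening by (fastforce simp: sigma_simps)

lemma substitution_scons:
  "substitution \<Delta> \<sigma> \<Gamma> \<Longrightarrow> \<Delta> \<turnstile> a \<Colon> subst \<sigma> A \<Longrightarrow> substitution \<Delta> (a \<cdot> \<sigma>) (A # \<Gamma>)"
  by (auto simp: substitution_def less_Suc_eq_0_disj)

section \<open>Derived rules\<close>

text \<open>The level is hidden. Cumulativity gives any two exo-types a common level, so formers and
  rules of the exo-layer need no bookkeeping of levels; types count as exo-types as well.\<close>

definition exotype :: "tm list \<Rightarrow> tm \<Rightarrow> bool" where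
  "exotype \<Gamma> A \<longleftrightarrow> (\<exists>i. \<Gamma> \<turnstile> A \<Colon> Univ Exo i)"

definition exoconv :: "tm list \<Rightarrow> tm \<Rightarrow> tm \<Rightarrow> bool" where
  "exoconv \<Gamma> A B \<longleftrightarrow> (\<exists>i. \<Gamma> \<turnstile> A \<doteq> B \<Colon> Univ Exo i)"

text \<open>For terms whose shape does not matter to later types, such as identities and proofs of
  contractibility.\<close>

definition inhabited :: "tm list \<Rightarrow> tm \<Rightarrow> bool" where
  "inhabited \<Gamma> A \<longleftrightarrow> (\<exists>t. \<Gamma> \<turnstile> t \<Colon> A)"

lemma inhabitedI: "\<Gamma> \<turnstile> t \<Colon> A \<Longrightarrow> inhabited \<Gamma> A"
  unfolding inhabited_def by blast

lemma cumul_le: "i \<le> j \<Longrightarrow> \<Gamma> \<turnstile> A \<Colon> Univ s i \<Longrightarrow> \<Gamma> \<turnstile> A \<Colon> Univ s j"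
  by (induction rule: dec_induct) (simp_all add: cumul)

lemma exotypeI: "\<Gamma> \<turnstile> A \<Colon> Univ s i \<Longrightarrow> exotype \<Gamma> A"
  unfolding exotype_def by (cases s) (auto intro: exo)

lemma exotype_imp_ctx: "exotype \<Gamma> A \<Longrightarrow> ctx (A # \<Gamma>)"
  unfolding exotype_def by (auto intro: ctx_cons)

lemma exotype_common_level:
  assumes "exotype \<Gamma> A" and "exotype \<Delta> B"
  obtains i where "\<Gamma> \<turnstile> A \<Colon> Univ Exo i" and "\<Delta> \<turnstile> B \<Colon> Univ Exo i"
proof -
  obtain i j where "\<Gamma> \<turnstile> A \<Colon> Univ Exo i" and "\<Delta> \<turnstile> B \<Colon> Univ Exo j"
    using assms unfolding exotype_def by blast
  then show thesis
    using that[of "max i j"] cumul_le[of i "max i j"] cumul_le[of j "max i j"] by simp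
qed

lemma exotype_Univ: "ctx \<Gamma> \<Longrightarrow> exotype \<Gamma> (Univ s i)"
  by (blast intro: exotypeI univ)

lemma exotype_Pi: "exotype \<Gamma> A \<Longrightarrow> exotype (A # \<Gamma>) B \<Longrightarrow> exotype \<Gamma> (Pi Exo A B)"
  by (erule (1) exotype_common_level) (blast intro: exotypeI pi_form)

lemma exotype_Sig: "exotype \<Gamma> A \<Longrightarrow> exotype (A # \<Gamma>) B \<Longrightarrow> exotype \<Gamma> (Sig Exo A B)"
  by (erule (1) exotype_common_level) (blast intro: exotypeI sig_form)

lemma exotype_Eq: "exotype \<Gamma> A \<Longrightarrow> \<Gamma> \<turnstile> a \<Colon> A \<Longrightarrow> \<Gamma> \<turnstile> b \<Colon> A \<Longrightarrow> exotype \<Gamma> (Eq Exo A a b)"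
  unfolding exotype_def by (blast intro: id_form)

lemma weakening_Univ: "\<Gamma> \<turnstile> T \<Colon> Univ s i \<Longrightarrow> ctx (A # \<Gamma>) \<Longrightarrow> A # \<Gamma> \<turnstile> lift T \<Colon> Univ s i"
  using weakening[of \<Gamma> T "Univ s i" A] by (simp add: ren.simps)

lemma exotype_lift: "exotype \<Gamma> T \<Longrightarrow> ctx (A # \<Gamma>) \<Longrightarrow> exotype (A # \<Gamma>) (lift T)"
  unfolding exotype_def by (blast intro: weakening_Univ)

lemma typing_subst_Univ:
  "\<Gamma> \<turnstile> T \<Colon> Univ s i \<Longrightarrow> substitution \<Delta> \<sigma> \<Gamma> \<Longrightarrow> \<Delta> \<turnstile> subst \<sigma> T \<Colon> Univ s i"
  using typing_subst[of \<Gamma> T "Univ s i"] by simp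

lemma exotype_subst: "exotype \<Gamma> T \<Longrightarrow> substitution \<Delta> \<sigma> \<Gamma> \<Longrightarrow> exotype \<Delta> (subst \<sigma> T)"
  unfolding exotype_def by (blast intro: typing_subst_Univ)

lemma exotype_arr: "exotype \<Gamma> A \<Longrightarrow> exotype \<Gamma> B \<Longrightarrow> exotype \<Gamma> (arr Exo A B)"
  unfolding arr_def by (blast intro: exotype_Pi exotype_lift exotype_imp_ctx)

lemma exotype_times: "exotype \<Gamma> A \<Longrightarrow> exotype \<Gamma> B \<Longrightarrow> exotype \<Gamma> (times Exo A B)"
  unfolding times_def by (blast intro: exotype_Sig exotype_lift exotype_imp_ctx)

lemma typing_Lam_exo:
  "exotype \<Gamma> A \<Longrightarrow> exotype (A # \<Gamma>) B \<Longrightarrow> A # \<Gamma> \<turnstile> b \<Colon> B \<Longrightarrow> \<Gamma> \<turnstile> Lam Exo A b \<Colon> Pi Exo A B"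
  by (erule (1) exotype_common_level) (blast intro: pi_intro)

lemma beta_exo:
  "exotype \<Gamma> A \<Longrightarrow> exotype (A # \<Gamma>) B \<Longrightarrow> A # \<Gamma> \<turnstile> b \<Colon> B \<Longrightarrow> \<Gamma> \<turnstile> a \<Colon> A \<Longrightarrow>
   \<Gamma> \<turnstile> App Exo (Lam Exo A b) a \<doteq> inst b a \<Colon> inst B a"
  by (erule (1) exotype_common_level) (blast intro: pi_beta)

lemma typing_Pair_exo:
  "exotype \<Gamma> A \<Longrightarrow> exotype (A # \<Gamma>) B \<Longrightarrow> \<Gamma> \<turnstile> a \<Colon> A \<Longrightarrow> \<Gamma> \<turnstile> b \<Colon> inst B a \<Longrightarrow>
   \<Gamma> \<turnstile> Pair Exo a b \<Colon> Sig Exo A B"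
  by (erule (1) exotype_common_level) (blast intro: sig_intro)

lemma typing_App_arr: "\<Gamma> \<turnstile> f \<Colon> arr s A B \<Longrightarrow> \<Gamma> \<turnstile> a \<Colon> A \<Longrightarrow> \<Gamma> \<turnstile> App s f a \<Colon> B"
  using pi_elim[of \<Gamma> f s A "lift B" a] by (simp add: arr_def sigma_simps)

lemma inhabited_Pi:
  "exotype \<Gamma> A \<Longrightarrow> exotype (A # \<Gamma>) B \<Longrightarrow> inhabited (A # \<Gamma>) B \<Longrightarrow> inhabited \<Gamma> (Pi Exo A B)"
  unfolding inhabited_def by (blast intro: typing_Lam_exo)

lemma inhabited_arr:
  "exotype \<Gamma> A \<Longrightarrow> exotype \<Gamma> B \<Longrightarrow> inhabited (A # \<Gamma>) (lift B) \<Longrightarrow> inhabited \<Gamma> (arr Exo A B)"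
  unfolding arr_def by (blast intro: inhabited_Pi exotype_lift exotype_imp_ctx)

lemma inhabited_times:
  assumes "exotype \<Gamma> A" "exotype \<Gamma> B" "inhabited \<Gamma> A" "inhabited \<Gamma> B"
  shows "inhabited \<Gamma> (times Exo A B)"
proof -
  obtain a b where "\<Gamma> \<turnstile> a \<Colon> A" "\<Gamma> \<turnstile> b \<Colon> B"
    using assms unfolding inhabited_def by blast
  then show ?thesis
    using typing_Pair_exo[of \<Gamma> A "lift B" a b] exotype_lift[OF assms(2) exotype_imp_ctx[OF assms(1)]]
      assms(1) by (simp add: times_def sigma_simps inhabitedI)
qed

lemma exoconv_retype: "\<Gamma> \<turnstile> t \<Colon> A \<Longrightarrow> exoconv \<Gamma> A B \<Longrightarrow> \<Gamma> \<turnstile> t \<Colon> B"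
  unfolding exoconv_def by (blast intro: retype)

lemma exoconv_sym: "exoconv \<Gamma> A B \<Longrightarrow> exoconv \<Gamma> B A"
  unfolding exoconv_def by (blast intro: eq_sym)

text \<open>Substitution preserves conversion because it can be expressed by a beta redex.\<close>

lemma exoconv_inst:
  assumes X: "exotype \<Gamma> X" and P: "exotype (X # \<Gamma>) P"
    and ab: "\<Gamma> \<turnstile> a \<doteq> b \<Colon> X" and a: "\<Gamma> \<turnstile> a \<Colon> X" and b: "\<Gamma> \<turnstile> b \<Colon> X"
  shows "exoconv \<Gamma> (inst P a) (inst P b)"
proof -
  obtain i where i: "X # \<Gamma> \<turnstile> P \<Colon> Univ Exo i"
    using P unfolding exotype_def by blast
  have U: "exotype (X # \<Gamma>) (Univ Exo i)"
    by (rule exotype_Univ[OF exotype_imp_ctx[OF X]])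
  note beta = beta_exo[OF X U i]
  have "\<Gamma> \<turnstile> App Exo (Lam Exo X P) a \<doteq> App Exo (Lam Exo X P) b \<Colon> Univ Exo i"
    using eq_app[OF eq_refl[OF typing_Lam_exo[OF X U i]] ab] by simp
  then have "\<Gamma> \<turnstile> inst P a \<doteq> inst P b \<Colon> Univ Exo i"
    using eq_trans[OF eq_trans[OF eq_sym[OF beta[OF a, simplified]]] beta[OF b, simplified]] by simp
  then show ?thesis
    unfolding exoconv_def by blast
qed

lemma conv_inst:
  assumes X: "exotype \<Gamma> X" and T: "exotype (X # \<Gamma>) T" and t: "X # \<Gamma> \<turnstile> t \<Colon> T"
    and ab: "\<Gamma> \<turnstile> a \<doteq> b \<Colon> X" and a: "\<Gamma> \<turnstile> a \<Colon> X" and b: "\<Gamma> \<turnstile> b \<Colon> X"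
  shows "\<Gamma> \<turnstile> inst t a \<doteq> inst t b \<Colon> inst T a"
proof -
  \<comment> \<open>The redex at \<open>b\<close> reduces at type \<open>inst T b\<close>; this
    conversion brings it to \<open>inst T a\<close>, where the two reductions can be
    chained.\<close>
  obtain i where i: "\<Gamma> \<turnstile> inst T b \<doteq> inst T a \<Colon> Univ Exo i"
    using exoconv_sym[OF exoconv_inst[OF X T ab a b]] unfolding exoconv_def by blast
  note beta = beta_exo[OF X T t]
  have "\<Gamma> \<turnstile> App Exo (Lam Exo X t) a \<doteq> App Exo (Lam Exo X t) b \<Colon> inst T a"
    using eq_app[OF eq_refl[OF typing_Lam_exo[OF X T t]] ab] .
  then show ?thesis
    by (rule eq_trans[OF eq_trans[OF eq_sym[OF beta[OF a]]] eq_retype[OF beta[OF b] i]])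
qed

lemma retype_inst:
  "exotype \<Gamma> X \<Longrightarrow> exotype (X # \<Gamma>) P \<Longrightarrow> \<Gamma> \<turnstile> a \<doteq> b \<Colon> X \<Longrightarrow> \<Gamma> \<turnstile> a \<Colon> X \<Longrightarrow> \<Gamma> \<turnstile> b \<Colon> X \<Longrightarrow>
   \<Gamma> \<turnstile> t \<Colon> inst P a \<Longrightarrow> \<Gamma> \<turnstile> t \<Colon> inst P b"
  by (blast intro: exoconv_retype exoconv_inst)

lemma ctx_ConsD: "ctx (A # \<Gamma>) \<Longrightarrow> ctx \<Gamma>"
  by (erule ctx.cases) (simp_all add: typing_imp_ctx(2))

lemma substitution_weaken1: "ctx (A # \<Gamma>) \<Longrightarrow> substitution (A # \<Gamma>) (shift 1) \<Gamma>"
  using substitution_shift_Suc[of \<Gamma> 0 \<Gamma> A] by (simp add: substitution_Var ctx_ConsD)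

lemma substitution_weaken2: "ctx (B # A # \<Gamma>) \<Longrightarrow> substitution (B # A # \<Gamma>) (shift 2) \<Gamma>"
  using substitution_shift_Suc[OF substitution_weaken1, of A \<Gamma> B] by (simp add: ctx_ConsD numeral_2_eq_2 numeral_3_eq_3)

lemma substitution_weaken3: "ctx (C # B # A # \<Gamma>) \<Longrightarrow> substitution (C # B # A # \<Gamma>) (shift 3) \<Gamma>"
  using substitution_shift_Suc[OF substitution_weaken2, of B A \<Gamma> C] by (simp add: ctx_ConsD numeral_2_eq_2 numeral_3_eq_3)

lemma typing_Var0: "ctx (A # \<Gamma>) \<Longrightarrow> A # \<Gamma> \<turnstile> Var 0 \<Colon> lift A"
  using typing_Var[of "A # \<Gamma>" 0] by (simp add: sigma_simps)

lemma typing_Var1: "ctx (B # A # \<Gamma>) \<Longrightarrow> B # A # \<Gamma> \<turnstile> Var 1 \<Colon> lift (lift A)"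
  using typing_Var[of "B # A # \<Gamma>" 1] by (simp add: sigma_simps)

lemma typing_Var2: "ctx (C # B # A # \<Gamma>) \<Longrightarrow> C # B # A # \<Gamma> \<turnstile> Var 2 \<Colon> lift (lift (lift A))"
  using typing_Var[of "C # B # A # \<Gamma>" 2] by (simp add: sigma_simps)

section \<open>Projections and transport\<close>

lemma subst_derived_formers [simp]:
  "subst \<sigma> (arr s A B) = arr s (subst \<sigma> A) (subst \<sigma> B)"
  "subst \<sigma> (times s A B) = times s (subst \<sigma> A) (subst \<sigma> B)"
  "subst \<sigma> (idfun s A) = idfun s (subst \<sigma> A)"
  "subst \<sigma> (comp s A f g) = comp s (subst \<sigma> A) (subst \<sigma> f) (subst \<sigma> g)"
  "subst \<sigma> (proj1 s A p) = proj1 s (subst \<sigma> A) (subst \<sigma> p)"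
  "subst \<sigma> (proj2 s A B p) = proj2 s (subst \<sigma> A) (subst (up \<sigma>) B) (subst \<sigma> p)"
  "subst \<sigma> (pi_exo A Y) = pi_exo (subst \<sigma> A) (subst \<sigma> Y)"
  "subst \<sigma> (is_contr A) = is_contr (subst \<sigma> A)"
  by (simp_all add: arr_def times_def idfun_def comp_def proj1_def proj2_def pi_exo_def is_contr_def
      sigma_simps)

lemma typing_proj1:
  assumes A: "\<Gamma> \<turnstile> A \<Colon> Univ s i" and B: "A # \<Gamma> \<turnstile> B \<Colon> Univ s i" and p: "\<Gamma> \<turnstile> p \<Colon> Sig s A B"
  shows "\<Gamma> \<turnstile> proj1 s A p \<Colon> A"
proof -
  have "Sig s A B # \<Gamma> \<turnstile> lift A \<Colon> Univ s i"
    by (rule weakening_Univ[OF A ctx_cons[OF sig_form[OF A B]]])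
  from sig_elim[OF this _ p, of "Var 1"] show ?thesis
    using typing_Var1[OF ctx_cons[OF B]] by (simp add: proj1_def sigma_simps)
qed

lemma proj1_Pair:
  assumes A: "\<Gamma> \<turnstile> A \<Colon> Univ s i" and B: "A # \<Gamma> \<turnstile> B \<Colon> Univ s i"
    and a: "\<Gamma> \<turnstile> a \<Colon> A" and b: "\<Gamma> \<turnstile> b \<Colon> inst B a"
  shows "\<Gamma> \<turnstile> proj1 s A (Pair s a b) \<doteq> a \<Colon> A"
proof -
  have "Sig s A B # \<Gamma> \<turnstile> lift A \<Colon> Univ s i"
    by (rule weakening_Univ[OF A ctx_cons[OF sig_form[OF A B]]])
  from sig_beta[OF A B this _ a b, of "Var 1"] show ?thesis
    using typing_Var1[OF ctx_cons[OF B]] by (simp add: proj1_def sigma_simps)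
qed

text \<open>The branch returns the second variable, of type \<open>B\<close> at the first variable,
  whereas the motive asks for \<open>B\<close> at the first projection of the pair. The beta rule
  \<open>proj1_Pair\<close> makes the two types convertible.\<close>

lemma typing_proj2:
  assumes A: "\<Gamma> \<turnstile> A \<Colon> Univ s i" and B: "A # \<Gamma> \<turnstile> B \<Colon> Univ s i" and p: "\<Gamma> \<turnstile> p \<Colon> Sig s A B"
  shows "\<Gamma> \<turnstile> proj2 s A B p \<Colon> inst B (proj1 s A p)"
proof -
  let ?S = "Sig s A B" and ?\<Delta> = "B # A # \<Gamma>"
  let ?C = "subst (proj1 s (lift A) (Var 0) \<cdot> shift 1) B"
  note S = sig_form[OF A B]
  note ctxS = ctx_cons[OF S] and ctx\<Delta> = ctx_cons[OF B]
  have up1: "substitution (lift A # X # \<Gamma>) (up (shift 1)) (A # \<Gamma>)" if "ctx (X # \<Gamma>)" for X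
    using substitution.up_closed[OF substitution_weaken1[OF that]]
      typing_subst_Univ[OF A substitution_weaken1[OF that]] by (simp add: sigma_simps)
  have "?S # \<Gamma> \<turnstile> proj1 s (lift A) (Var 0) \<Colon> lift A"
    using typing_proj1[OF weakening_Univ[OF A ctxS] typing_subst_Univ[OF B up1[OF ctxS]], of "Var 0"]
      typing_Var0[OF ctxS] by (simp add: sigma_simps)
  then have "substitution (?S # \<Gamma>) (proj1 s (lift A) (Var 0) \<cdot> shift 1) (A # \<Gamma>)"
    using substitution_scons[OF substitution_weaken1[OF ctxS]] by (simp add: lift_conv_subst)
  note C = typing_subst_Univ[OF B this]
  note w2 = substitution_weaken2[OF ctx\<Delta>]
  have A2: "?\<Delta> \<turnstile> subst (shift 2) A \<Colon> Univ s i"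
    by (rule typing_subst_Univ[OF A w2])
  note up2 = substitution.up_closed[OF w2 A2]
  have v1: "?\<Delta> \<turnstile> Var 1 \<Colon> subst (shift 2) A" and v0: "?\<Delta> \<turnstile> Var 0 \<Colon> lift B"
    using typing_Var1[OF ctx\<Delta>] typing_Var0[OF ctx\<Delta>] by (simp_all add: sigma_simps)
  have B2: "subst (shift 2) A # ?\<Delta> \<turnstile> subst (up (shift 2)) B \<Colon> Univ s i"
    by (rule typing_subst_Univ[OF B up2])
  have v0': "?\<Delta> \<turnstile> Var 0 \<Colon> inst (subst (up (shift 2)) B) (Var 1)"
    using v0 by (simp add: sigma_simps)
  have pair: "?\<Delta> \<turnstile> Pair s (Var 1) (Var 0) \<Colon> Sig s (subst (shift 2) A) (subst (up (shift 2)) B)"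
    by (rule sig_intro[OF A2 B2 v1 v0'])
  have "?\<Delta> \<turnstile> Var 0 \<Colon>
      inst (subst (up (shift 2)) B) (proj1 s (subst (shift 2) A) (Pair s (Var 1) (Var 0)))"
    by (rule retype_inst[OF exotypeI[OF A2] exotypeI[OF B2] eq_sym[OF proj1_Pair[OF A2 B2 v1 v0']] v1
          typing_proj1[OF A2 B2 pair] v0'])
  then have "?\<Delta> \<turnstile> Var 0 \<Colon> subst (Pair s (Var 1) (Var 0) \<cdot> shift 2) ?C"
    by (simp add: sigma_simps)
  from sig_elim[OF C this p] show ?thesis
    by (simp add: proj2_def sigma_simps)
qed

lemma inhabited_App_arr: "inhabited \<Gamma> (arr s A B) \<Longrightarrow> inhabited \<Gamma> A \<Longrightarrow> inhabited \<Gamma> B"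
  unfolding inhabited_def by (blast intro: typing_App_arr)

text \<open>The motive is the function type from \<open>P\<close> at one endpoint to
  \<open>P\<close> at the other, so the identity function is the branch and the element at
  \<open>a\<close> is supplied afterwards. The layer is a parameter: the same argument serves
  identity, for families of types, and exo-equality, for families of exo-types.\<close>

lemma transport:
  assumes T: "\<Gamma> \<turnstile> T \<Colon> Univ s i" and P: "T # \<Gamma> \<turnstile> P \<Colon> Univ s j"
    and a: "\<Gamma> \<turnstile> a \<Colon> T" and b: "\<Gamma> \<turnstile> b \<Colon> T" and p: "\<Gamma> \<turnstile> p \<Colon> Eq s T a b"
    and x: "inhabited \<Gamma> (inst P a)"
  shows "inhabited \<Gamma> (inst P b)"
proof -
  let ?\<Delta> = "Eq s (lift (lift T)) (Var 1) (Var 0) # lift T # T # \<Gamma>"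
  let ?C = "arr s (subst (Var 2 \<cdot> shift 3) P) (subst (Var 1 \<cdot> shift 3) P)"
  note c1 = ctx_cons[OF T]
  note T1 = weakening_Univ[OF T c1]
  note c2 = ctx_cons[OF T1]
  have "lift T # T # \<Gamma> \<turnstile> Eq s (lift (lift T)) (Var 1) (Var 0) \<Colon> Univ s i"
    by (rule id_form[OF weakening_Univ[OF T1 c2] typing_Var1[OF c2] typing_Var0[OF c2]])
  note c3 = ctx_cons[OF this]
  have "?\<Delta> \<turnstile> Var 2 \<Colon> subst (shift 3) T" "?\<Delta> \<turnstile> Var 1 \<Colon> subst (shift 3) T"
    using typing_Var2[OF c3] typing_Var1[OF c3] by (simp_all add: sigma_simps)
  then have P2: "?\<Delta> \<turnstile> subst (Var 2 \<cdot> shift 3) P \<Colon> Univ s j"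
    and P1: "?\<Delta> \<turnstile> subst (Var 1 \<cdot> shift 3) P \<Colon> Univ s j"
    by - (rule typing_subst_Univ[OF P substitution_scons[OF substitution_weaken3[OF c3]]], assumption)+
  have C: "?\<Delta> \<turnstile> ?C \<Colon> Univ s j"
    unfolding arr_def by (rule pi_form[OF P2 weakening_Univ[OF P1 ctx_cons[OF P2]]])
  have "T # \<Gamma> \<turnstile> Lam s P (Var 0) \<Colon> arr s P P"
    unfolding arr_def
    by (rule pi_intro[OF P weakening_Univ[OF P ctx_cons[OF P]] typing_Var0[OF ctx_cons[OF P]]])
  then have "T # \<Gamma> \<turnstile> Lam s P (Var 0) \<Colon> subst (Refl s (Var 0) \<cdot> Var 0 \<cdot> Var 0 \<cdot> shift 1) ?C"
    by (simp add: sigma_simps)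
  from id_elim[OF C this a b p] have "inhabited \<Gamma> (arr s (inst P a) (inst P b))"
    by (simp add: sigma_simps inhabitedI)
  then show ?thesis
    using x by (rule inhabited_App_arr)
qed

lemma inhabited_Eq_sym:
  assumes T: "\<Gamma> \<turnstile> T \<Colon> Univ s i"
    and a: "\<Gamma> \<turnstile> a \<Colon> T" and b: "\<Gamma> \<turnstile> b \<Colon> T" and p: "\<Gamma> \<turnstile> p \<Colon> Eq s T a b"
  shows "inhabited \<Gamma> (Eq s T b a)"
proof -
  note c = ctx_cons[OF T]
  have "inhabited \<Gamma> (inst (Eq s (lift T) (Var 0) (lift a)) b)"
    using transport[OF T id_form[OF weakening_Univ[OF T c] typing_Var0[OF c] weakening[OF a c]] a b p]
      inhabitedI[OF id_intro[OF T a]] by (simp add: sigma_simps)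
  then show ?thesis
    by (simp add: sigma_simps)
qed

section \<open>Contractible types\<close>

lemma typing_is_contr:
  assumes A: "\<Gamma> \<turnstile> A \<Colon> Univ Inn i"
  shows "\<Gamma> \<turnstile> is_contr A \<Colon> Univ Inn i"
    and "A # \<Gamma> \<turnstile> Pi Inn (lift A) (Eq Inn (lift (lift A)) (Var 1) (Var 0)) \<Colon> Univ Inn i"
proof -
  note c1 = ctx_cons[OF A]
  note A1 = weakening_Univ[OF A c1]
  note c2 = ctx_cons[OF A1]
  show "A # \<Gamma> \<turnstile> Pi Inn (lift A) (Eq Inn (lift (lift A)) (Var 1) (Var 0)) \<Colon> Univ Inn i"
    by (rule pi_form[OF A1 id_form[OF weakening_Univ[OF A1 c2] typing_Var1[OF c2] typing_Var0[OF c2]]])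
  then show "\<Gamma> \<turnstile> is_contr A \<Colon> Univ Inn i"
    unfolding is_contr_def by (rule sig_form[OF A])
qed

lemma typing_center:
  assumes "\<Gamma> \<turnstile> A \<Colon> Univ Inn i" and "\<Gamma> \<turnstile> c \<Colon> is_contr A"
  shows "\<Gamma> \<turnstile> proj1 Inn A c \<Colon> A"
  using typing_proj1[OF assms(1) typing_is_contr(2)[OF assms(1)]] assms(2) by (simp add: is_contr_def)

lemma inhabited_center_path:
  assumes A: "\<Gamma> \<turnstile> A \<Colon> Univ Inn i" and c: "\<Gamma> \<turnstile> c \<Colon> is_contr A" and x: "\<Gamma> \<turnstile> x \<Colon> A"
  shows "inhabited \<Gamma> (Eq Inn A (proj1 Inn A c) x)"
proof -
  have "\<Gamma> \<turnstile> proj2 Inn A (Pi Inn (lift A) (Eq Inn (lift (lift A)) (Var 1) (Var 0))) c \<Colon>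
      Pi Inn A (Eq Inn (lift A) (lift (proj1 Inn A c)) (Var 0))"
    using typing_proj2[OF A typing_is_contr(2)[OF A]] c by (simp add: is_contr_def sigma_simps)
  from pi_elim[OF this x] show ?thesis
    by (simp add: sigma_simps inhabitedI)
qed

lemma inhabited_is_contr:
  assumes A: "\<Gamma> \<turnstile> A \<Colon> Univ Inn i" and a: "\<Gamma> \<turnstile> a \<Colon> A"
    and p: "inhabited (A # \<Gamma>) (Eq Inn (lift A) (lift a) (Var 0))"
  shows "inhabited \<Gamma> (is_contr A)"
proof -
  note c = ctx_cons[OF A]
  obtain q where q: "A # \<Gamma> \<turnstile> q \<Colon> Eq Inn (lift A) (lift a) (Var 0)"
    using p unfolding inhabited_def by blast
  have "\<Gamma> \<turnstile> Lam Inn A q \<Colon> Pi Inn A (Eq Inn (lift A) (lift a) (Var 0))"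
    by (rule pi_intro[OF A id_form[OF weakening_Univ[OF A c] weakening[OF a c] typing_Var0[OF c]] q])
  then show ?thesis
    using sig_intro[OF A typing_is_contr(2)[OF A] a, of "Lam Inn A q"]
    by (simp add: is_contr_def sigma_simps inhabitedI)
qed

text \<open>Two transports, from \<open>x\<close> to the center and from there to \<open>y\<close>,
  take the place of a concatenated path.\<close>

lemma contr_transport:
  assumes A: "\<Gamma> \<turnstile> A \<Colon> Univ Inn i" and c: "inhabited \<Gamma> (is_contr A)" and P: "A # \<Gamma> \<turnstile> P \<Colon> Univ Inn j"
    and x: "\<Gamma> \<turnstile> x \<Colon> A" and y: "\<Gamma> \<turnstile> y \<Colon> A" and Px: "inhabited \<Gamma> (inst P x)"
  shows "inhabited \<Gamma> (inst P y)"
proof -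
  obtain d where d: "\<Gamma> \<turnstile> d \<Colon> is_contr A"
    using c unfolding inhabited_def by blast
  note z = typing_center[OF A d]
  obtain p q where p: "\<Gamma> \<turnstile> p \<Colon> Eq Inn A (proj1 Inn A d) x" and q: "\<Gamma> \<turnstile> q \<Colon> Eq Inn A (proj1 Inn A d) y"
    using inhabited_center_path[OF A d x] inhabited_center_path[OF A d y] unfolding inhabited_def by blast
  obtain p' where "\<Gamma> \<turnstile> p' \<Colon> Eq Inn A x (proj1 Inn A d)"
    using inhabited_Eq_sym[OF A z x p] unfolding inhabited_def by blast
  from transport[OF A P z y q transport[OF A P x z this Px]] show ?thesis .
qed

section \<open>Contractibility of singletons\<close>

abbreviation singleton :: "tm \<Rightarrow> tm \<Rightarrow> tm" where
  "singleton B b \<equiv> Sig Inn B (Eq Inn (lift B) (lift b) (Var 0))"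

lemma typing_singleton:
  assumes B: "\<Gamma> \<turnstile> B \<Colon> Univ Inn i" and b: "\<Gamma> \<turnstile> b \<Colon> B"
  shows "B # \<Gamma> \<turnstile> Eq Inn (lift B) (lift b) (Var 0) \<Colon> Univ Inn i"
    and "\<Gamma> \<turnstile> singleton B b \<Colon> Univ Inn i"
proof -
  note c = ctx_cons[OF B]
  show "B # \<Gamma> \<turnstile> Eq Inn (lift B) (lift b) (Var 0) \<Colon> Univ Inn i"
    by (rule id_form[OF weakening_Univ[OF B c] weakening[OF b c] typing_Var0[OF c]])
  then show "\<Gamma> \<turnstile> singleton B b \<Colon> Univ Inn i"
    by (rule sig_form[OF B])
qed

lemma typing_singleton_Pair:
  assumes B: "\<Gamma> \<turnstile> B \<Colon> Univ Inn i" and b: "\<Gamma> \<turnstile> b \<Colon> B" and y: "\<Gamma> \<turnstile> y \<Colon> B" and p: "\<Gamma> \<turnstile> p \<Colon> Eq Inn B b y"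
  shows "\<Gamma> \<turnstile> Pair Inn y p \<Colon> singleton B b"
  using sig_intro[OF B typing_singleton(1)[OF B b] y] p by (simp add: sigma_simps)

text \<open>Identity elimination here varies both endpoints. The motive therefore lets
  \<open>b\<close> vary too, and with it the singleton type and its center; at reflexivity the two
  pairs coincide.\<close>

lemma inhabited_singleton_path:
  assumes B: "\<Gamma> \<turnstile> B \<Colon> Univ Inn i" and b: "\<Gamma> \<turnstile> b \<Colon> B" and y: "\<Gamma> \<turnstile> y \<Colon> B" and p: "\<Gamma> \<turnstile> p \<Colon> Eq Inn B b y"
  shows "inhabited \<Gamma> (Eq Inn (singleton B b) (Pair Inn b (Refl Inn b)) (Pair Inn y p))"
proof -
  let ?\<Delta> = "Eq Inn (lift (lift B)) (Var 1) (Var 0) # lift B # B # \<Gamma>"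
  let ?B3 = "lift (lift (lift B))"
  let ?C = "Eq Inn (singleton ?B3 (Var 2)) (Pair Inn (Var 2) (Refl Inn (Var 2))) (Pair Inn (Var 1) (Var 0))"
  note c1 = ctx_cons[OF B]
  note B1 = weakening_Univ[OF B c1]
  note c2 = ctx_cons[OF B1]
  note B2 = weakening_Univ[OF B1 c2]
  have "lift B # B # \<Gamma> \<turnstile> Eq Inn (lift (lift B)) (Var 1) (Var 0) \<Colon> Univ Inn i"
    by (rule id_form[OF B2 typing_Var1[OF c2] typing_Var0[OF c2]])
  note c3 = ctx_cons[OF this]
  note B3 = weakening_Univ[OF B2 c3]
  have v2: "?\<Delta> \<turnstile> Var 2 \<Colon> ?B3" and v1: "?\<Delta> \<turnstile> Var 1 \<Colon> ?B3" and v0: "?\<Delta> \<turnstile> Var 0 \<Colon> Eq Inn ?B3 (Var 2) (Var 1)"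
    using typing_Var2[OF c3] typing_Var1[OF c3] typing_Var0[OF c3] by (simp_all add: sigma_simps)
  have C: "?\<Delta> \<turnstile> ?C \<Colon> Univ Inn i"
    by (rule id_form[OF typing_singleton(2)[OF B3 v2] typing_singleton_Pair[OF B3 v2 v2 id_intro[OF B3 v2]]
          typing_singleton_Pair[OF B3 v2 v1 v0]])
  note v = typing_Var0[OF c1]
  have "B # \<Gamma> \<turnstile> Refl Inn (Pair Inn (Var 0) (Refl Inn (Var 0))) \<Colon>
      subst (Refl Inn (Var 0) \<cdot> Var 0 \<cdot> Var 0 \<cdot> shift 1) ?C"
    using id_intro[OF typing_singleton(2)[OF B1 v] typing_singleton_Pair[OF B1 v v id_intro[OF B1 v]]]
    by (simp add: sigma_simps)
  from id_elim[OF C this b y p] show ?thesis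
    by (simp add: sigma_simps inhabitedI)
qed

text \<open>The rules contain no eta law for pairs, so a general \<open>z\<close> must be eliminated
  to a pair before the path at explicit pairs applies.\<close>

lemma inhabited_singleton_center_path:
  assumes B: "\<Gamma> \<turnstile> B \<Colon> Univ Inn i" and b: "\<Gamma> \<turnstile> b \<Colon> B" and z: "\<Gamma> \<turnstile> z \<Colon> singleton B b"
  shows "inhabited \<Gamma> (Eq Inn (singleton B b) (Pair Inn b (Refl Inn b)) z)"
proof -
  let ?S = "singleton B b" and ?u = "Pair Inn b (Refl Inn b)"
  let ?C = "Eq Inn (lift ?S) (lift ?u) (Var 0)"
  let ?E = "Eq Inn (lift B) (lift b) (Var 0)"
  note E = typing_singleton(1)[OF B b] and S = typing_singleton(2)[OF B b]
  note u = typing_singleton_Pair[OF B b b id_intro[OF B b]]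
  note cS = ctx_cons[OF S] and cB = ctx_cons[OF B] and cE = ctx_cons[OF E]
  have C: "?S # \<Gamma> \<turnstile> ?C \<Colon> Univ Inn i"
    by (rule id_form[OF weakening_Univ[OF S cS] weakening[OF u cS] typing_Var0[OF cS]])
  have v0: "?E # B # \<Gamma> \<turnstile> Var 0 \<Colon> Eq Inn (lift (lift B)) (lift (lift b)) (Var 1)"
    using typing_Var0[OF cE] by (simp add: sigma_simps)
  obtain g where "?E # B # \<Gamma> \<turnstile> g \<Colon>
      Eq Inn (singleton (lift (lift B)) (lift (lift b))) (Pair Inn (lift (lift b)) (Refl Inn (lift (lift b))))
        (Pair Inn (Var 1) (Var 0))"
    using inhabited_singleton_path[OF weakening_Univ[OF weakening_Univ[OF B cB] cE]
        weakening[OF weakening[OF b cB] cE] typing_Var1[OF cE] v0]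
    unfolding inhabited_def by blast
  then have "?E # B # \<Gamma> \<turnstile> g \<Colon> subst (Pair Inn (Var 1) (Var 0) \<cdot> shift 2) ?C"
    by (simp add: sigma_simps)
  from sig_elim[OF C this z] show ?thesis
    by (simp add: sigma_simps inhabitedI)
qed

lemma inhabited_is_contr_singleton:
  assumes B: "\<Gamma> \<turnstile> B \<Colon> Univ Inn i" and b: "\<Gamma> \<turnstile> b \<Colon> B"
  shows "inhabited \<Gamma> (is_contr (singleton B b))"
proof (rule inhabited_is_contr[OF typing_singleton(2)[OF B b]
      typing_singleton_Pair[OF B b b id_intro[OF B b]]])
  note c = ctx_cons[OF typing_singleton(2)[OF B b]]
  have "singleton B b # \<Gamma> \<turnstile> Var 0 \<Colon> singleton (lift B) (lift b)"
    using typing_Var0[OF c] by (simp add: sigma_simps)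
  from inhabited_singleton_center_path[OF weakening_Univ[OF B c] weakening[OF b c] this]
  show "inhabited (singleton B b # \<Gamma>)
      (Eq Inn (lift (singleton B b)) (lift (Pair Inn b (Refl Inn b))) (Var 0))"
    by (simp add: sigma_simps)
qed

section \<open>Exo-isomorphisms and fibrant matches\<close>

lemma typing_proj1_exo:
  "exotype \<Gamma> A \<Longrightarrow> exotype (A # \<Gamma>) B \<Longrightarrow> \<Gamma> \<turnstile> p \<Colon> Sig Exo A B \<Longrightarrow> \<Gamma> \<turnstile> proj1 Exo A p \<Colon> A"
  by (erule (1) exotype_common_level) (rule typing_proj1)

lemma typing_proj2_exo:
  "exotype \<Gamma> A \<Longrightarrow> exotype (A # \<Gamma>) B \<Longrightarrow> \<Gamma> \<turnstile> p \<Colon> Sig Exo A B \<Longrightarrow>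
   \<Gamma> \<turnstile> proj2 Exo A B p \<Colon> inst B (proj1 Exo A p)"
  by (erule (1) exotype_common_level) (rule typing_proj2)

lemma typing_idfun: "exotype \<Gamma> A \<Longrightarrow> \<Gamma> \<turnstile> idfun Exo A \<Colon> arr Exo A A"
  unfolding idfun_def arr_def
  by (intro typing_Lam_exo exotype_lift typing_Var0 exotype_imp_ctx)

lemma weakening_arr: "\<Gamma> \<turnstile> f \<Colon> arr s A B \<Longrightarrow> ctx (X # \<Gamma>) \<Longrightarrow> X # \<Gamma> \<turnstile> lift f \<Colon> arr s (lift A) (lift B)"
  using weakening[of \<Gamma> f "arr s A B" X] by (simp add: sigma_simps)

lemma comp_body:
  assumes "exotype \<Gamma> A" and "\<Gamma> \<turnstile> g \<Colon> arr Exo A B" and "\<Gamma> \<turnstile> f \<Colon> arr Exo B C"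
  shows "A # \<Gamma> \<turnstile> App Exo (lift f) (App Exo (lift g) (Var 0)) \<Colon> lift C"
proof -
  note c = exotype_imp_ctx[OF assms(1)]
  show ?thesis
    by (rule typing_App_arr[OF weakening_arr[OF assms(3) c]
          typing_App_arr[OF weakening_arr[OF assms(2) c] typing_Var0[OF c]]])
qed

lemma typing_comp:
  assumes "exotype \<Gamma> A" and "exotype \<Gamma> C" and "\<Gamma> \<turnstile> g \<Colon> arr Exo A B" and "\<Gamma> \<turnstile> f \<Colon> arr Exo B C"
  shows "\<Gamma> \<turnstile> comp Exo A f g \<Colon> arr Exo A C"
  unfolding comp_def arr_def[of Exo A C]
  by (intro typing_Lam_exo exotype_lift exotype_imp_ctx comp_body[OF _ assms(3,4)] assms(1,2))

abbreviation inverse_laws :: "tm \<Rightarrow> tm \<Rightarrow> tm \<Rightarrow> tm \<Rightarrow> tm" where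
  "inverse_laws A B f g \<equiv>
     times Exo (Eq Exo (arr Exo B B) (comp Exo B f g) (idfun Exo B))
               (Eq Exo (arr Exo A A) (comp Exo A g f) (idfun Exo A))"

lemma exotype_inverse_law:
  assumes "exotype \<Gamma> A" "\<Gamma> \<turnstile> f \<Colon> arr Exo A B" "\<Gamma> \<turnstile> g \<Colon> arr Exo B A"
  shows "exotype \<Gamma> (Eq Exo (arr Exo A A) (comp Exo A g f) (idfun Exo A))"
  by (intro exotype_Eq exotype_arr typing_comp[OF _ _ assms(2)] typing_idfun assms)

lemma exotype_inverse_laws:
  assumes "exotype \<Gamma> A" "exotype \<Gamma> B" "\<Gamma> \<turnstile> f \<Colon> arr Exo A B" "\<Gamma> \<turnstile> g \<Colon> arr Exo B A"
  shows "exotype \<Gamma> (inverse_laws A B f g)"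
  by (intro exotype_times exotype_inverse_law[of _ _ _ B] exotype_inverse_law[of _ _ _ A] assms)

lemma exo_iso_alt:
  "exo_iso A B = Sig Exo (arr Exo A B) (Sig Exo (arr Exo (lift B) (lift A))
     (inverse_laws (lift (lift A)) (lift (lift B)) (Var 1) (Var 0)))"
  by (simp add: exo_iso_def Let_def)

lemma exotype_inverses:
  assumes A: "exotype \<Gamma> A" and B: "exotype \<Gamma> B" and f: "\<Gamma> \<turnstile> f \<Colon> arr Exo A B"
  shows "exotype (arr Exo B A # \<Gamma>) (inverse_laws (lift A) (lift B) (lift f) (Var 0))"
proof -
  note c = exotype_imp_ctx[OF exotype_arr[OF B A]]
  have "arr Exo B A # \<Gamma> \<turnstile> Var 0 \<Colon> arr Exo (lift B) (lift A)"
    using typing_Var0[OF c] by (simp add: sigma_simps)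
  then show ?thesis
    by (intro exotype_inverse_laws exotype_lift A B weakening_arr f c)
qed

lemma exotype_exo_iso_body:
  assumes A: "exotype \<Gamma> A" and B: "exotype \<Gamma> B"
  shows "exotype (arr Exo A B # \<Gamma>) (Sig Exo (arr Exo (lift B) (lift A))
     (inverse_laws (lift (lift A)) (lift (lift B)) (Var 1) (Var 0)))"
proof -
  note c = exotype_imp_ctx[OF exotype_arr[OF A B]]
  note A1 = exotype_lift[OF A c] and B1 = exotype_lift[OF B c]
  have "arr Exo A B # \<Gamma> \<turnstile> Var 0 \<Colon> arr Exo (lift A) (lift B)"
    using typing_Var0[OF c] by (simp add: sigma_simps)
  from exotype_Sig[OF exotype_arr[OF B1 A1] exotype_inverses[OF A1 B1 this]] show ?thesis
    by (simp add: sigma_simps)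
qed

lemma exotype_exo_iso: "exotype \<Gamma> A \<Longrightarrow> exotype \<Gamma> B \<Longrightarrow> exotype \<Gamma> (exo_iso A B)"
  unfolding exo_iso_alt by (intro exotype_Sig exotype_arr exotype_exo_iso_body)

lemma typing_iso_map:
  "exotype \<Gamma> A \<Longrightarrow> exotype \<Gamma> B \<Longrightarrow> \<Gamma> \<turnstile> e \<Colon> exo_iso A B \<Longrightarrow> \<Gamma> \<turnstile> proj1 Exo (arr Exo A B) e \<Colon> arr Exo A B"
  unfolding exo_iso_alt by (rule typing_proj1_exo[OF exotype_arr exotype_exo_iso_body])

text \<open>The forward map is pinned to the first projection by an equation, since
  \<open>fmatch_map\<close> is that very term; the inverse and the laws are needed only up to
  existence.\<close>

lemma exo_iso_inverse:
  assumes A: "exotype \<Gamma> A" and B: "exotype \<Gamma> B" and e: "\<Gamma> \<turnstile> e \<Colon> exo_iso A B"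
    and f: "f = proj1 Exo (arr Exo A B) e"
  obtains g p q where "\<Gamma> \<turnstile> g \<Colon> arr Exo B A"
    and "\<Gamma> \<turnstile> p \<Colon> Eq Exo (arr Exo B B) (comp Exo B f g) (idfun Exo B)"
    and "\<Gamma> \<turnstile> q \<Colon> Eq Exo (arr Exo A A) (comp Exo A g f) (idfun Exo A)"
proof -
  have tf: "\<Gamma> \<turnstile> f \<Colon> arr Exo A B"
    unfolding f by (rule typing_iso_map[OF A B e])
  have "\<Gamma> \<turnstile> proj2 Exo (arr Exo A B) (Sig Exo (arr Exo (lift B) (lift A))
      (inverse_laws (lift (lift A)) (lift (lift B)) (Var 1) (Var 0))) e
    \<Colon> Sig Exo (arr Exo B A) (inverse_laws (lift A) (lift B) (lift f) (Var 0))"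
    using typing_proj2_exo[OF exotype_arr[OF A B] exotype_exo_iso_body[OF A B] e[unfolded exo_iso_alt]]
    by (simp add: f sigma_simps)
  then obtain u where u: "\<Gamma> \<turnstile> u \<Colon> Sig Exo (arr Exo B A) (inverse_laws (lift A) (lift B) (lift f) (Var 0))" ..
  define g where "g = proj1 Exo (arr Exo B A) u"
  note BA = exotype_arr[OF B A] and I = exotype_inverses[OF A B tf]
  have g: "\<Gamma> \<turnstile> g \<Colon> arr Exo B A"
    unfolding g_def by (rule typing_proj1_exo[OF BA I u])
  let ?p = "Eq Exo (arr Exo B B) (comp Exo B f g) (idfun Exo B)"
  let ?q = "Eq Exo (arr Exo A A) (comp Exo A g f) (idfun Exo A)"
  obtain v where v: "\<Gamma> \<turnstile> v \<Colon> Sig Exo ?p (lift ?q)"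
    using typing_proj2_exo[OF BA I u] by (auto simp: times_def g_def[symmetric] sigma_simps)
  have p: "exotype \<Gamma> ?p" and q: "exotype \<Gamma> ?q"
    by (rule exotype_inverse_law[OF B g tf], rule exotype_inverse_law[OF A tf g])
  note q1 = exotype_lift[OF q exotype_imp_ctx[OF p]]
  show thesis
    using that[OF g typing_proj1_exo[OF p q1 v]] typing_proj2_exo[OF p q1 v] by (simp add: sigma_simps)
qed

text \<open>Replaces \<open>g (f x)\<close> by \<open>x\<close> although the two are merely
  exo-equal. Applied with f = r_Y, g = s_Y it uses one law of the isomorphism, with the roles
  exchanged the other.\<close>

lemma retract_transport:
  assumes X: "exotype \<Gamma> X" and f: "\<Gamma> \<turnstile> f \<Colon> arr Exo X Z" and g: "\<Gamma> \<turnstile> g \<Colon> arr Exo Z X"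
    and q: "\<Gamma> \<turnstile> q \<Colon> Eq Exo (arr Exo X X) (comp Exo X g f) (idfun Exo X)"
    and P: "exotype (X # \<Gamma>) P" and x: "\<Gamma> \<turnstile> x \<Colon> X"
    and t: "inhabited \<Gamma> (inst P (App Exo g (App Exo f x)))"
  shows "inhabited \<Gamma> (inst P x)"
proof -
  let ?T = "arr Exo X X"
  \<comment> \<open>The motive is \<open>P\<close> at \<open>h x\<close>, with \<open>h\<close>
    ranging over the endomaps of \<open>X\<close>. The equation between functions is thus eliminated
    as it stands, and beta evaluates \<open>h x\<close> for the composite and for the
    identity.\<close>
  let ?Q = "subst (App Exo (Var 0) (lift x) \<cdot> shift 1) P"
  note T = exotype_arr[OF X X] and cX = exotype_imp_ctx[OF X]
  note c = exotype_imp_ctx[OF T]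
  have v: "?T # \<Gamma> \<turnstile> Var 0 \<Colon> arr Exo (lift X) (lift X)"
    using typing_Var0[OF c] by (simp add: sigma_simps)
  have "?T # \<Gamma> \<turnstile> App Exo (Var 0) (lift x) \<Colon> lift X"
    by (rule typing_App_arr[OF v weakening[OF x c]])
  then have Q: "exotype (?T # \<Gamma>) ?Q"
    using exotype_subst[OF P substitution_scons[OF substitution_weaken1[OF c]]]
    by (simp add: sigma_simps)
  note comp = typing_comp[OF X X f g] and id = typing_idfun[OF X]
  note gfx = typing_App_arr[OF g typing_App_arr[OF f x]]
  have comp_beta: "\<Gamma> \<turnstile> App Exo (comp Exo X g f) x \<doteq> App Exo g (App Exo f x) \<Colon> X"
    using beta_exo[OF X exotype_lift[OF X cX] comp_body[OF X f g] x] by (simp add: comp_def sigma_simps)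
  have id_beta: "\<Gamma> \<turnstile> App Exo (idfun Exo X) x \<doteq> x \<Colon> X"
    using beta_exo[OF X exotype_lift[OF X cX] typing_Var0[OF cX] x] by (simp add: idfun_def sigma_simps)
  obtain t where "\<Gamma> \<turnstile> t \<Colon> inst P (App Exo g (App Exo f x))"
    using t unfolding inhabited_def by blast
  from retype_inst[OF X P eq_sym[OF comp_beta] gfx typing_App_arr[OF comp x] this]
  have "inhabited \<Gamma> (inst ?Q (comp Exo X g f))"
    by (simp add: sigma_simps inhabitedI)
  then have "inhabited \<Gamma> (inst ?Q (idfun Exo X))"
    using T Q transport[OF _ _ comp id q] unfolding exotype_def by blast
  then obtain t' where "\<Gamma> \<turnstile> t' \<Colon> inst P (App Exo (idfun Exo X) x)"
    unfolding inhabited_def by (auto simp: sigma_simps)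
  from retype_inst[OF X P id_beta typing_App_arr[OF id x] x this] show ?thesis
    by (rule inhabitedI)
qed

section \<open>Families, sections and their fibrant matches\<close>

lemma subst_fibrancy_formers [simp]:
  "subst \<sigma> (exo_iso A B) = exo_iso (subst \<sigma> A) (subst \<sigma> B)"
  "subst \<sigma> (fibrant k A) = fibrant k (subst \<sigma> A)"
  "subst \<sigma> (families i A) = families i (subst \<sigma> A)"
  "subst \<sigma> (pi_fibrant i k A) = pi_fibrant i k (subst \<sigma> A)"
  "subst \<sigma> (fmatch k H Y) = fmatch k (subst \<sigma> H) (subst \<sigma> Y)"
  "subst \<sigma> (fmatch_map k A H Y) = fmatch_map k (subst \<sigma> A) (subst \<sigma> H) (subst \<sigma> Y)"
  by (simp_all add: exo_iso_alt fibrant_def families_def pi_fibrant_def fmatch_def fmatch_map_def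
      sigma_simps)

lemma exotype_families: "exotype \<Gamma> A \<Longrightarrow> exotype \<Gamma> (families i A)"
  unfolding families_def using exotype_imp_ctx ctx_ConsD by (intro exotype_arr exotype_Univ) blast+

lemma typing_App_family: "\<Gamma> \<turnstile> Y \<Colon> families i A \<Longrightarrow> \<Gamma> \<turnstile> a \<Colon> A \<Longrightarrow> \<Gamma> \<turnstile> App Exo Y a \<Colon> Univ Inn i"
  unfolding families_def by (rule typing_App_arr)

lemma weakening_family:
  "\<Gamma> \<turnstile> Y \<Colon> families i A \<Longrightarrow> ctx (X # \<Gamma>) \<Longrightarrow> X # \<Gamma> \<turnstile> lift Y \<Colon> families i (lift A)"
  using weakening[of \<Gamma> Y "families i A" X] by (simp add: sigma_simps)

lemma weakening_section:
  "\<Gamma> \<turnstile> f \<Colon> pi_exo A Y \<Longrightarrow> ctx (X # \<Gamma>) \<Longrightarrow> X # \<Gamma> \<turnstile> lift f \<Colon> pi_exo (lift A) (lift Y)"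
  using weakening[of \<Gamma> f "pi_exo A Y" X] by (simp add: sigma_simps)

lemma weakening_pi_fibrant:
  "\<Gamma> \<turnstile> H \<Colon> pi_fibrant i k A \<Longrightarrow> ctx (X # \<Gamma>) \<Longrightarrow> X # \<Gamma> \<turnstile> lift H \<Colon> pi_fibrant i k (lift A)"
  using weakening[of \<Gamma> H "pi_fibrant i k A" X] by (simp add: sigma_simps)

lemma typing_fibre:
  "exotype \<Gamma> A \<Longrightarrow> \<Gamma> \<turnstile> Y \<Colon> families i A \<Longrightarrow> A # \<Gamma> \<turnstile> App Exo (lift Y) (Var 0) \<Colon> Univ Inn i"
  using exotype_imp_ctx by (blast intro: typing_App_family weakening_family typing_Var0)

lemma exotype_pi_exo: "exotype \<Gamma> A \<Longrightarrow> \<Gamma> \<turnstile> Y \<Colon> families i A \<Longrightarrow> exotype \<Gamma> (pi_exo A Y)"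
  unfolding pi_exo_def by (intro exotype_Pi exotypeI[OF typing_fibre])

lemma typing_App_section: "\<Gamma> \<turnstile> f \<Colon> pi_exo A Y \<Longrightarrow> \<Gamma> \<turnstile> a \<Colon> A \<Longrightarrow> \<Gamma> \<turnstile> App Exo f a \<Colon> App Exo Y a"
  using pi_elim[of \<Gamma> f Exo A "App Exo (lift Y) (Var 0)" a] by (simp add: pi_exo_def sigma_simps)

lemma typing_section:
  "exotype \<Gamma> A \<Longrightarrow> \<Gamma> \<turnstile> Y \<Colon> families i A \<Longrightarrow> A # \<Gamma> \<turnstile> b \<Colon> App Exo (lift Y) (Var 0) \<Longrightarrow>
   \<Gamma> \<turnstile> Lam Exo A b \<Colon> pi_exo A Y"
  unfolding pi_exo_def by (rule typing_Lam_exo[OF _ exotypeI[OF typing_fibre]])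

lemma exotype_fibrant_body:
  assumes "exotype \<Gamma> A"
  shows "exotype (Univ Inn k # \<Gamma>) (exo_iso (lift A) (Var 0))"
proof -
  have c: "ctx (Univ Inn k # \<Gamma>)"
    using assms by (blast intro: exotype_imp_ctx exotype_Univ ctx_ConsD)
  have "Univ Inn k # \<Gamma> \<turnstile> Var 0 \<Colon> Univ Inn k"
    using typing_Var0[OF c] by (simp add: sigma_simps)
  then show ?thesis
    by (intro exotype_exo_iso exotype_lift assms c exotypeI)
qed

lemma exotype_fibrant: "exotype \<Gamma> A \<Longrightarrow> exotype \<Gamma> (fibrant k A)"
  unfolding fibrant_def
  by (intro exotype_Sig exotype_fibrant_body exotype_Univ) (blast intro: exotype_imp_ctx ctx_ConsD)+

lemma exotype_pi_fibrant:
  assumes A: "exotype \<Gamma> A"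
  shows "exotype \<Gamma> (pi_fibrant i k A)"
proof -
  note c = exotype_imp_ctx[OF exotype_families[OF A]]
  have "families i A # \<Gamma> \<turnstile> Var 0 \<Colon> families i (lift A)"
    using typing_Var0[OF c] by (simp add: sigma_simps)
  then show ?thesis
    unfolding pi_fibrant_def
    by (intro exotype_Pi exotype_families exotype_fibrant exotype_pi_exo exotype_lift A c)
qed

context
  fixes \<Gamma> A H Y i k
  assumes A: "exotype \<Gamma> A" and H: "\<Gamma> \<turnstile> H \<Colon> pi_fibrant i k A" and Y: "\<Gamma> \<turnstile> Y \<Colon> families i A"
begin

private lemma typing_match: "\<Gamma> \<turnstile> App Exo H Y \<Colon> fibrant k (pi_exo A Y)"
  using pi_elim[OF H[unfolded pi_fibrant_def] Y] by (simp add: sigma_simps)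

private lemma exotypes:
  "exotype \<Gamma> (pi_exo A Y)"
  "exotype \<Gamma> (Univ Inn k)"
  "exotype (Univ Inn k # \<Gamma>) (exo_iso (lift (pi_exo A Y)) (Var 0))"
proof -
  show "exotype \<Gamma> (pi_exo A Y)"
    by (rule exotype_pi_exo[OF A Y])
  then show "exotype (Univ Inn k # \<Gamma>) (exo_iso (lift (pi_exo A Y)) (Var 0))"
    by (rule exotype_fibrant_body)
  show "exotype \<Gamma> (Univ Inn k)"
    by (rule exotype_Univ[OF ctx_ConsD[OF exotype_imp_ctx[OF A]]])
qed

lemma typing_fmatch: "\<Gamma> \<turnstile> fmatch k H Y \<Colon> Univ Inn k"
  unfolding fmatch_def by (rule typing_proj1_exo[OF exotypes(2,3) typing_match[unfolded fibrant_def]])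

private lemma typing_match_iso:
  "\<Gamma> \<turnstile> proj2 Exo (Univ Inn k) (exo_iso (lift (pi_exo A Y)) (Var 0)) (App Exo H Y)
     \<Colon> exo_iso (pi_exo A Y) (fmatch k H Y)"
  using typing_proj2_exo[OF exotypes(2,3) typing_match[unfolded fibrant_def]]
  by (simp add: fmatch_def sigma_simps)

lemma typing_fmatch_map: "\<Gamma> \<turnstile> fmatch_map k A H Y \<Colon> arr Exo (pi_exo A Y) (fmatch k H Y)"
  unfolding fmatch_map_def
  by (rule typing_iso_map[OF exotypes(1) exotypeI[OF typing_fmatch] typing_match_iso])

lemma fmatch_inverse:
  obtains g p q where "\<Gamma> \<turnstile> g \<Colon> arr Exo (fmatch k H Y) (pi_exo A Y)"
    and "\<Gamma> \<turnstile> p \<Colon> Eq Exo (arr Exo (fmatch k H Y) (fmatch k H Y))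
           (comp Exo (fmatch k H Y) (fmatch_map k A H Y) g) (idfun Exo (fmatch k H Y))"
    and "\<Gamma> \<turnstile> q \<Colon> Eq Exo (arr Exo (pi_exo A Y) (pi_exo A Y))
           (comp Exo (pi_exo A Y) g (fmatch_map k A H Y)) (idfun Exo (pi_exo A Y))"
  by (rule exo_iso_inverse[OF exotypes(1) exotypeI[OF typing_fmatch] typing_match_iso fmatch_map_def])

end

section \<open>Contractibility and function extensionality\<close>

abbreviation homotopies :: "tm \<Rightarrow> tm \<Rightarrow> tm \<Rightarrow> tm \<Rightarrow> tm" where
  "homotopies A Y f g \<equiv> Pi Exo A
     (Eq Inn (App Exo (lift Y) (Var 0)) (App Exo (lift f) (Var 0)) (App Exo (lift g) (Var 0)))"

abbreviation contr_fibres :: "tm \<Rightarrow> tm \<Rightarrow> tm" where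
  "contr_fibres A Y \<equiv> Pi Exo A (is_contr (App Exo (lift Y) (Var 0)))"

text \<open>Exhibits the premise as \<open>contr_fibres\<close> of the bound family, so that
  instantiating the binder yields the same expression at the given family.\<close>

lemma contr_preserving_alt:
  "contr_preserving i k A H = Pi Exo (families i A)
     (arr Exo (contr_fibres (lift A) (Var 0)) (is_contr (fmatch k (lift H) (Var 0))))"
  by (simp add: contr_preserving_def sigma_simps)

lemma cofibrant_funext_alt:
  "cofibrant_funext i k A H = Pi Exo (families i A) (Pi Exo (pi_exo (lift A) (Var 0))
     (Pi Exo (pi_exo (lift (lift A)) (Var 1))
       (arr Exo (homotopies (lift (lift (lift A))) (Var 2) (Var 1) (Var 0))
         (Eq Inn (fmatch k (lift (lift (lift H))) (Var 2))
            (App Exo (fmatch_map k (lift (lift (lift A))) (lift (lift (lift H))) (Var 2)) (Var 1))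
            (App Exo (fmatch_map k (lift (lift (lift A))) (lift (lift (lift H))) (Var 2)) (Var 0))))))"
  by (simp add: cofibrant_funext_def Let_def sigma_simps)

lemma subst_contr_preserving [simp]:
  "subst \<sigma> (contr_preserving i k A H) = contr_preserving i k (subst \<sigma> A) (subst \<sigma> H)"
  by (simp add: contr_preserving_alt sigma_simps)

lemma subst_cofibrant_funext [simp]:
  "subst \<sigma> (cofibrant_funext i k A H) = cofibrant_funext i k (subst \<sigma> A) (subst \<sigma> H)"
  by (simp add: cofibrant_funext_alt sigma_simps)

lemma apply_contr_preserving:
  assumes "\<Gamma> \<turnstile> c \<Colon> contr_preserving i k A H" and "\<Gamma> \<turnstile> Y \<Colon> families i A" and "\<Gamma> \<turnstile> w \<Colon> contr_fibres A Y"
  shows "inhabited \<Gamma> (is_contr (fmatch k H Y))"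
proof -
  have "\<Gamma> \<turnstile> App Exo c Y \<Colon> arr Exo (contr_fibres A Y) (is_contr (fmatch k H Y))"
    using pi_elim[OF assms(1)[unfolded contr_preserving_alt] assms(2)] by (simp add: sigma_simps)
  from typing_App_arr[OF this assms(3)] show ?thesis
    by (rule inhabitedI)
qed

lemma apply_cofibrant_funext:
  assumes F: "\<Gamma> \<turnstile> F \<Colon> cofibrant_funext i k A H" and Y: "\<Gamma> \<turnstile> Y \<Colon> families i A"
    and f: "\<Gamma> \<turnstile> f \<Colon> pi_exo A Y" and g: "\<Gamma> \<turnstile> g \<Colon> pi_exo A Y" and h: "\<Gamma> \<turnstile> h \<Colon> homotopies A Y f g"
  shows "inhabited \<Gamma> (Eq Inn (fmatch k H Y) (App Exo (fmatch_map k A H Y) f) (App Exo (fmatch_map k A H Y) g))"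
proof -
  have "\<Gamma> \<turnstile> App Exo F Y \<Colon> Pi Exo (pi_exo A Y) (Pi Exo (pi_exo (lift A) (lift Y))
       (arr Exo (homotopies (lift (lift A)) (lift (lift Y)) (Var 1) (Var 0))
         (Eq Inn (fmatch k (lift (lift H)) (lift (lift Y)))
            (App Exo (fmatch_map k (lift (lift A)) (lift (lift H)) (lift (lift Y))) (Var 1))
            (App Exo (fmatch_map k (lift (lift A)) (lift (lift H)) (lift (lift Y))) (Var 0)))))"
    using pi_elim[OF F[unfolded cofibrant_funext_alt] Y] by (simp add: sigma_simps)
  from pi_elim[OF this f] have "\<Gamma> \<turnstile> App Exo (App Exo F Y) f \<Colon> Pi Exo (pi_exo A Y)
       (arr Exo (homotopies (lift A) (lift Y) (lift f) (Var 0))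
         (Eq Inn (fmatch k (lift H) (lift Y))
            (App Exo (fmatch_map k (lift A) (lift H) (lift Y)) (lift f))
            (App Exo (fmatch_map k (lift A) (lift H) (lift Y)) (Var 0))))"
    by (simp add: sigma_simps)
  from pi_elim[OF this g] have "\<Gamma> \<turnstile> App Exo (App Exo (App Exo F Y) f) g \<Colon> arr Exo (homotopies A Y f g)
      (Eq Inn (fmatch k H Y) (App Exo (fmatch_map k A H Y) f) (App Exo (fmatch_map k A H Y) g))"
    by (simp add: sigma_simps)
  from typing_App_arr[OF this h] show ?thesis
    by (rule inhabitedI)
qed

lemma exotype_homotopies:
  assumes A: "exotype \<Gamma> A" and Y: "\<Gamma> \<turnstile> Y \<Colon> families i A"
    and f: "\<Gamma> \<turnstile> f \<Colon> pi_exo A Y" and g: "\<Gamma> \<turnstile> g \<Colon> pi_exo A Y"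
  shows "A # \<Gamma> \<turnstile> Eq Inn (App Exo (lift Y) (Var 0)) (App Exo (lift f) (Var 0)) (App Exo (lift g) (Var 0))
      \<Colon> Univ Inn i"
    and "exotype \<Gamma> (homotopies A Y f g)"
proof -
  note c = exotype_imp_ctx[OF A]
  note v = typing_Var0[OF c]
  show *: "A # \<Gamma> \<turnstile> Eq Inn (App Exo (lift Y) (Var 0)) (App Exo (lift f) (Var 0)) (App Exo (lift g) (Var 0))
      \<Colon> Univ Inn i"
    by (rule id_form[OF typing_fibre[OF A Y] typing_App_section[OF weakening_section[OF f c] v]
          typing_App_section[OF weakening_section[OF g c] v]])
  show "exotype \<Gamma> (homotopies A Y f g)"
    by (rule exotype_Pi[OF A exotypeI[OF *]])
qed

lemma exotype_contr_fibres:
  "exotype \<Gamma> A \<Longrightarrow> \<Gamma> \<turnstile> Y \<Colon> families i A \<Longrightarrow> exotype \<Gamma> (contr_fibres A Y)"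
  by (rule exotype_Pi[OF _ exotypeI[OF typing_is_contr(1)[OF typing_fibre]]])

lemma typing_App_Var0:
  "\<Gamma> \<turnstile> f \<Colon> Pi Exo A B \<Longrightarrow> ctx (A # \<Gamma>) \<Longrightarrow> A # \<Gamma> \<turnstile> App Exo (lift f) (Var 0) \<Colon> B"
  using pi_elim[OF _ typing_Var0, of A \<Gamma> "lift f" Exo "subst (up (shift 1)) B"]
    weakening[of \<Gamma> f "Pi Exo A B" A] by (simp add: sigma_simps)

text \<open>Evaluates a function under a further binder over its own domain: the lifted body,
  instantiated at the new variable, is the original body because the shift cancels.\<close>

lemma beta_Var0:
  assumes A: "exotype \<Gamma> A" and B: "exotype (A # \<Gamma>) B" and b: "A # \<Gamma> \<turnstile> b \<Colon> B"
  shows "A # \<Gamma> \<turnstile> App Exo (lift (Lam Exo A b)) (Var 0) \<doteq> b \<Colon> B"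
proof -
  note c = exotype_imp_ctx[OF A]
  obtain j where "A # \<Gamma> \<turnstile> subst (shift 1) A \<Colon> Univ Exo j"
    using exotype_lift[OF A c] unfolding exotype_def by (auto simp: sigma_simps)
  note up = substitution.up_closed[OF substitution_weaken1[OF c] this]
  have "exotype (A # \<Gamma>) (subst (shift 1) A)"
    using exotype_lift[OF A c] by (simp add: sigma_simps)
  from beta_exo[OF this exotype_subst[OF B up] typing_subst[OF b up], of "Var 0"] show ?thesis
    using typing_Var0[OF c] by (simp add: sigma_simps)
qed

text \<open>Serves two purposes: on a proof of fibrewise contractibility it is the section of
  centers, and on a section of the singleton family it forgets the paths.\<close>

definition pointwise_proj1 :: "tm \<Rightarrow> tm \<Rightarrow> tm \<Rightarrow> tm" where
  "pointwise_proj1 A Y w = Lam Exo A (proj1 Inn (App Exo (lift Y) (Var 0)) (App Exo (lift w) (Var 0)))"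

lemma subst_pointwise_proj1 [simp]:
  "subst \<sigma> (pointwise_proj1 A Y w) = pointwise_proj1 (subst \<sigma> A) (subst \<sigma> Y) (subst \<sigma> w)"
  by (simp add: pointwise_proj1_def sigma_simps)

section \<open>From function extensionality to contractibility\<close>

context
  fixes \<Gamma> A H Y i k
  assumes A: "exotype \<Gamma> A" and H: "\<Gamma> \<turnstile> H \<Colon> pi_fibrant i k A" and Y: "\<Gamma> \<turnstile> Y \<Colon> families i A"
begin

private lemma typing_center_fibre:
  assumes w: "\<Gamma> \<turnstile> w \<Colon> contr_fibres A Y"
  shows "A # \<Gamma> \<turnstile> App Exo (lift w) (Var 0) \<Colon> is_contr (App Exo (lift Y) (Var 0))"
    and "A # \<Gamma> \<turnstile> proj1 Inn (App Exo (lift Y) (Var 0)) (App Exo (lift w) (Var 0)) \<Colon> App Exo (lift Y) (Var 0)"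
    and "\<Gamma> \<turnstile> pointwise_proj1 A Y w \<Colon> pi_exo A Y"
proof -
  note c = exotype_imp_ctx[OF A]
  show wa: "A # \<Gamma> \<turnstile> App Exo (lift w) (Var 0) \<Colon> is_contr (App Exo (lift Y) (Var 0))"
    by (rule typing_App_Var0[OF w c])
  show *: "A # \<Gamma> \<turnstile> proj1 Inn (App Exo (lift Y) (Var 0)) (App Exo (lift w) (Var 0)) \<Colon> App Exo (lift Y) (Var 0)"
    by (rule typing_center[OF typing_fibre[OF A Y] wa])
  show "\<Gamma> \<turnstile> pointwise_proj1 A Y w \<Colon> pi_exo A Y"
    unfolding pointwise_proj1_def by (rule typing_section[OF A Y *])
qed

lemma typing_center_fmatch:
  "\<Gamma> \<turnstile> w \<Colon> contr_fibres A Y \<Longrightarrow>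
   \<Gamma> \<turnstile> App Exo (fmatch_map k A H Y) (pointwise_proj1 A Y w) \<Colon> fmatch k H Y"
  by (rule typing_App_arr[OF typing_fmatch_map[OF A H Y] typing_center_fibre(3)])

lemma inhabited_fmatch_path:
  assumes F: "\<Gamma> \<turnstile> F \<Colon> cofibrant_funext i k A H" and w: "\<Gamma> \<turnstile> w \<Colon> contr_fibres A Y"
    and x: "\<Gamma> \<turnstile> x \<Colon> fmatch k H Y"
  shows "inhabited \<Gamma> (Eq Inn (fmatch k H Y) (App Exo (fmatch_map k A H Y) (pointwise_proj1 A Y w)) x)"
proof -
  let ?FM = "fmatch k H Y" and ?r = "fmatch_map k A H Y" and ?z = "pointwise_proj1 A Y w"
  let ?Ya = "App Exo (lift Y) (Var 0)"
  obtain s p where s: "\<Gamma> \<turnstile> s \<Colon> arr Exo ?FM (pi_exo A Y)"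
    and p: "\<Gamma> \<turnstile> p \<Colon> Eq Exo (arr Exo ?FM ?FM) (comp Exo ?FM ?r s) (idfun Exo ?FM)"
    using fmatch_inverse[OF A H Y] by blast
  let ?sx = "App Exo s x"
  note c = exotype_imp_ctx[OF A]
  note FM = typing_fmatch[OF A H Y]
  note cFM = ctx_cons[OF FM]
  note Ya = typing_fibre[OF A Y]
  note sx = typing_App_arr[OF s x]
  note z = typing_center_fibre(3)[OF w] and za = typing_center_fibre(2)[OF w]
  have sxa: "A # \<Gamma> \<turnstile> App Exo (lift ?sx) (Var 0) \<Colon> ?Ya"
    by (rule typing_App_section[OF weakening_section[OF sx c] typing_Var0[OF c]])
  have za': "A # \<Gamma> \<turnstile> App Exo (lift ?z) (Var 0) \<Colon> ?Ya"
    by (rule typing_App_section[OF weakening_section[OF z c] typing_Var0[OF c]])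
  obtain h where h: "A # \<Gamma> \<turnstile> h \<Colon> Eq Inn ?Ya (proj1 Inn ?Ya (App Exo (lift w) (Var 0))) (App Exo (lift ?sx) (Var 0))"
    using inhabited_center_path[OF Ya typing_center_fibre(1)[OF w] sxa] unfolding inhabited_def by blast
  \<comment> \<open>The contraction starts at the center itself, while a homotopy has to start at
    the section of centers applied to the variable; the two differ by a beta step.\<close>
  have beta: "A # \<Gamma> \<turnstile> proj1 Inn ?Ya (App Exo (lift w) (Var 0)) \<doteq> App Exo (lift ?z) (Var 0) \<Colon> ?Ya"
    using eq_sym[OF beta_Var0[OF A exotypeI[OF Ya] za]] unfolding pointwise_proj1_def .
  have "A # \<Gamma> \<turnstile> h \<Colon> Eq Inn ?Ya (App Exo (lift ?z) (Var 0)) (App Exo (lift ?sx) (Var 0))"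
    by (rule retype[OF h eq_id[OF eq_refl[OF Ya] beta eq_refl[OF sxa]]])
  from typing_Lam_exo[OF A exotypeI[OF exotype_homotopies(1)[OF A Y z sx]] this]
  have "inhabited \<Gamma> (Eq Inn ?FM (App Exo ?r ?z) (App Exo ?r ?sx))"
    by (rule apply_cofibrant_funext[OF F Y z sx])
  then have "inhabited \<Gamma> (inst (Eq Inn (lift ?FM) (lift (App Exo ?r ?z)) (Var 0)) (App Exo ?r ?sx))"
    by (simp add: sigma_simps)
  \<comment> \<open>The law on the side of FM_Y: the retract is FM_Y itself, with s_Y as first and
    r_Y as second map.\<close>
  from retract_transport[OF exotypeI[OF FM] s typing_fmatch_map[OF A H Y] p _ x this]
  have "inhabited \<Gamma> (inst (Eq Inn (lift ?FM) (lift (App Exo ?r ?z)) (Var 0)) x)"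
    using exotypeI[OF id_form[OF weakening_Univ[OF FM cFM] weakening[OF typing_center_fmatch[OF w] cFM]
          typing_Var0[OF cFM]]] by blast
  then show ?thesis
    by (simp add: sigma_simps)
qed

end

lemma weakening_contr_fibres:
  "\<Gamma> \<turnstile> w \<Colon> contr_fibres A Y \<Longrightarrow> ctx (X # \<Gamma>) \<Longrightarrow> X # \<Gamma> \<turnstile> lift w \<Colon> contr_fibres (lift A) (lift Y)"
  using weakening[of \<Gamma> w "contr_fibres A Y" X] by (simp add: sigma_simps)

lemma weakening_cofibrant_funext:
  "\<Gamma> \<turnstile> F \<Colon> cofibrant_funext i k A H \<Longrightarrow> ctx (X # \<Gamma>) \<Longrightarrow>
   X # \<Gamma> \<turnstile> lift F \<Colon> cofibrant_funext i k (lift A) (lift H)"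
  using weakening[of \<Gamma> F "cofibrant_funext i k A H" X] by (simp add: sigma_simps)

lemma weakening_contr_preserving:
  "\<Gamma> \<turnstile> c \<Colon> contr_preserving i k A H \<Longrightarrow> ctx (X # \<Gamma>) \<Longrightarrow>
   X # \<Gamma> \<turnstile> lift c \<Colon> contr_preserving i k (lift A) (lift H)"
  using weakening[of \<Gamma> c "contr_preserving i k A H" X] by (simp add: sigma_simps)

lemma inhabited_is_contr_fmatch:
  assumes A: "exotype \<Gamma> A" and H: "\<Gamma> \<turnstile> H \<Colon> pi_fibrant i k A" and Y: "\<Gamma> \<turnstile> Y \<Colon> families i A"
    and F: "\<Gamma> \<turnstile> F \<Colon> cofibrant_funext i k A H" and w: "\<Gamma> \<turnstile> w \<Colon> contr_fibres A Y"
  shows "inhabited \<Gamma> (is_contr (fmatch k H Y))"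
proof (rule inhabited_is_contr[OF typing_fmatch[OF A H Y] typing_center_fmatch[OF A H Y w]])
  note c = ctx_cons[OF typing_fmatch[OF A H Y]]
  have "fmatch k H Y # \<Gamma> \<turnstile> Var 0 \<Colon> fmatch k (lift H) (lift Y)"
    using typing_Var0[OF c] by (simp add: sigma_simps)
  \<comment> \<open>The path is required at a variable of FM_Y, so all data are weakened and the
    path is taken in the extended context.\<close>
  from inhabited_fmatch_path[OF exotype_lift[OF A c] weakening_pi_fibrant[OF H c] weakening_family[OF Y c]
      weakening_cofibrant_funext[OF F c] weakening_contr_fibres[OF w c] this]
  show "inhabited (fmatch k H Y # \<Gamma>) (Eq Inn (lift (fmatch k H Y))
      (lift (App Exo (fmatch_map k A H Y) (pointwise_proj1 A Y w))) (Var 0))"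
    by (simp add: sigma_simps)
qed

section \<open>The family of singletons and its sections\<close>

definition singleton_family :: "tm \<Rightarrow> tm \<Rightarrow> tm \<Rightarrow> tm" where
  "singleton_family A Y f = Lam Exo A (singleton (App Exo (lift Y) (Var 0)) (App Exo (lift f) (Var 0)))"

lemma subst_singleton_family [simp]:
  "subst \<sigma> (singleton_family A Y f) = singleton_family (subst \<sigma> A) (subst \<sigma> Y) (subst \<sigma> f)"
  by (simp add: singleton_family_def sigma_simps)

context
  fixes \<Gamma> A Y f i
  assumes A: "exotype \<Gamma> A" and Y: "\<Gamma> \<turnstile> Y \<Colon> families i A" and f: "\<Gamma> \<turnstile> f \<Colon> pi_exo A Y"
begin

private abbreviation (input) "Ya \<equiv> App Exo (lift Y) (Var 0)"
private abbreviation (input) "fa \<equiv> App Exo (lift f) (Var 0)"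

private lemmas c = exotype_imp_ctx[OF A]
private lemmas typing_Ya = typing_fibre[OF A Y]

private lemma typing_section_Var0: "\<Gamma> \<turnstile> z \<Colon> pi_exo A Y \<Longrightarrow> A # \<Gamma> \<turnstile> App Exo (lift z) (Var 0) \<Colon> Ya"
  by (rule typing_App_section[OF weakening_section[OF _ c] typing_Var0[OF c]])

private lemma typing_singleton_fibre: "A # \<Gamma> \<turnstile> singleton Ya fa \<Colon> Univ Inn i"
  by (rule typing_singleton(2)[OF typing_Ya typing_section_Var0[OF f]])

lemma typing_singleton_family: "\<Gamma> \<turnstile> singleton_family A Y f \<Colon> families i A"
  using typing_Lam_exo[OF A exotype_Univ[OF c] typing_singleton_fibre]
  by (simp add: singleton_family_def families_def arr_def sigma_simps)

text \<open>The family is an abstraction, so its value at the variable is a redex, convertible but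
  not equal to the singleton type. Passages between the two go through this conversion.\<close>

private lemma singleton_family_Var0:
  "A # \<Gamma> \<turnstile> App Exo (lift (singleton_family A Y f)) (Var 0) \<doteq> singleton Ya fa \<Colon> Univ Inn i"
  unfolding singleton_family_def by (rule beta_Var0[OF A exotype_Univ[OF c] typing_singleton_fibre])

lemma inhabited_contr_singleton_family: "inhabited \<Gamma> (contr_fibres A (singleton_family A Y f))"
proof -
  let ?Y' = "App Exo (lift (singleton_family A Y f)) (Var 0)"
  have U: "exotype (A # \<Gamma>) (Univ Inn i)"
    by (rule exotype_Univ[OF c])
  note Y' = typing_fibre[OF A typing_singleton_family]
  \<comment> \<open>Contractibility is viewed as a family over the universe, into which the
    conversion of the redex to the singleton can be substituted.\<close>
  have "Univ Inn i # A # \<Gamma> \<turnstile> Var 0 \<Colon> Univ Inn i"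
    using typing_Var0[OF exotype_imp_ctx[OF U]] by (simp add: sigma_simps)
  note P = exotypeI[OF typing_is_contr(1)[OF this]]
  obtain t where "A # \<Gamma> \<turnstile> t \<Colon> inst (is_contr (Var 0)) (singleton Ya fa)"
    using inhabited_is_contr_singleton[OF typing_Ya typing_section_Var0[OF f]]
    unfolding inhabited_def by auto
  from retype_inst[OF U P eq_sym[OF singleton_family_Var0] typing_singleton_fibre Y' this]
  have "inhabited (A # \<Gamma>) (is_contr ?Y')"
    by (simp add: inhabitedI)
  from inhabited_Pi[OF A exotypeI[OF typing_is_contr(1)[OF Y']] this] show ?thesis .
qed

private lemma typing_App_singleton_family:
  assumes "\<Gamma> \<turnstile> w \<Colon> pi_exo A (singleton_family A Y f)"
  shows "A # \<Gamma> \<turnstile> App Exo (lift w) (Var 0) \<Colon> singleton Ya fa"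
  by (rule retype[OF typing_App_section[OF weakening_section[OF assms c] typing_Var0[OF c]]
        singleton_family_Var0])

lemma typing_pointwise_proj1:
  assumes w: "\<Gamma> \<turnstile> w \<Colon> pi_exo A (singleton_family A Y f)"
  shows "\<Gamma> \<turnstile> pointwise_proj1 A Y w \<Colon> pi_exo A Y"
  unfolding pointwise_proj1_def
  by (rule typing_section[OF A Y typing_proj1[OF typing_Ya typing_singleton(1)[OF typing_Ya
          typing_section_Var0[OF f]] typing_App_singleton_family[OF w]]])

text \<open>A homotopy from \<open>f\<close> to \<open>z\<close> is what it takes to lift
  \<open>z\<close> to a section of singletons. The lift projects back to \<open>z\<close> by
  conversion, so no function extensionality enters.\<close>

lemma singleton_section:
  assumes z: "\<Gamma> \<turnstile> z \<Colon> pi_exo A Y" and h: "inhabited \<Gamma> (homotopies A Y f z)"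
  obtains u where "\<Gamma> \<turnstile> u \<Colon> pi_exo A (singleton_family A Y f)"
    and "\<Gamma> \<turnstile> pointwise_proj1 A Y u \<doteq> z \<Colon> pi_exo A Y"
proof -
  let ?za = "App Exo (lift z) (Var 0)" and ?S = "singleton Ya fa"
  note za = typing_section_Var0[OF z] and fa = typing_section_Var0[OF f]
  obtain q where "\<Gamma> \<turnstile> q \<Colon> homotopies A Y f z"
    using h unfolding inhabited_def by blast
  then have q: "A # \<Gamma> \<turnstile> App Exo (lift q) (Var 0) \<Colon> Eq Inn Ya fa ?za"
    by (rule typing_App_Var0[OF _ c])
  let ?pair = "Pair Inn ?za (App Exo (lift q) (Var 0))"
  let ?u = "Lam Exo A ?pair"
  let ?ua = "App Exo (lift ?u) (Var 0)"
  note S = typing_singleton_fibre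
  note pair = typing_singleton_Pair[OF typing_Ya fa za q]
  have u: "\<Gamma> \<turnstile> ?u \<Colon> pi_exo A (singleton_family A Y f)"
    by (rule typing_section[OF A typing_singleton_family retype[OF pair eq_sym[OF singleton_family_Var0]]])
  have ua: "A # \<Gamma> \<turnstile> ?ua \<doteq> ?pair \<Colon> ?S"
    by (rule beta_Var0[OF A exotypeI[OF S] pair])
  note cS = ctx_cons[OF S]
  note Ya1 = weakening_Univ[OF typing_Ya cS]
  have fa1: "?S # A # \<Gamma> \<turnstile> lift fa \<Colon> lift Ya"
    by (rule weakening[OF fa cS])
  have "?S # A # \<Gamma> \<turnstile> Var 0 \<Colon> singleton (lift Ya) (lift fa)"
    using typing_Var0[OF cS] by (simp add: sigma_simps)
  note t = typing_proj1[OF Ya1 typing_singleton(1)[OF Ya1 fa1] this]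
  have "A # \<Gamma> \<turnstile> proj1 Inn Ya ?ua \<doteq> proj1 Inn Ya ?pair \<Colon> Ya"
    using conv_inst[OF exotypeI[OF S] exotypeI[OF Ya1] t ua typing_App_singleton_family[OF u] pair]
    by (simp add: sigma_simps)
  moreover have "A # \<Gamma> \<turnstile> proj1 Inn Ya ?pair \<doteq> ?za \<Colon> Ya"
    using proj1_Pair[OF typing_Ya typing_singleton(1)[OF typing_Ya fa] za] q by (simp add: sigma_simps)
  ultimately have ptw: "A # \<Gamma> \<turnstile> proj1 Inn Ya ?ua \<doteq> ?za \<Colon> Ya"
    by (rule eq_trans)
  \<comment> \<open>Since the values agree judgementally, congruence of abstraction equates the
    sections, and eta recovers \<open>z\<close>.\<close>
  have "\<Gamma> \<turnstile> pointwise_proj1 A Y ?u \<doteq> Lam Exo A ?za \<Colon> pi_exo A Y"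
    unfolding pointwise_proj1_def pi_exo_def
    by (rule exotype_common_level[OF A exotypeI[OF typing_Ya]]) (rule eq_lam[OF eq_refl _ ptw])
  moreover have "\<Gamma> \<turnstile> Lam Exo A ?za \<doteq> z \<Colon> pi_exo A Y"
    using eq_sym[OF pi_eta[OF z[unfolded pi_exo_def]]] unfolding pi_exo_def .
  ultimately show thesis
    using that[OF u] by (blast intro: eq_trans)
qed

end

section \<open>From contractibility to function extensionality\<close>

lemma typing_App_fmatch_map_proj1:
  assumes "exotype \<Gamma> A" and "\<Gamma> \<turnstile> H \<Colon> pi_fibrant i k A" and "\<Gamma> \<turnstile> Y \<Colon> families i A"
    and "\<Gamma> \<turnstile> f \<Colon> pi_exo A Y" and "\<Gamma> \<turnstile> w \<Colon> pi_exo A (singleton_family A Y f)"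
  shows "\<Gamma> \<turnstile> App Exo (fmatch_map k A H Y) (pointwise_proj1 A Y w) \<Colon> fmatch k H Y"
  by (rule typing_App_arr[OF typing_fmatch_map typing_pointwise_proj1]) (rule assms)+

lemma inhabited_fmatch_homotopy:
  assumes A: "exotype \<Gamma> A" and H: "\<Gamma> \<turnstile> H \<Colon> pi_fibrant i k A" and Y: "\<Gamma> \<turnstile> Y \<Colon> families i A"
    and d: "\<Gamma> \<turnstile> d \<Colon> contr_preserving i k A H"
    and f: "\<Gamma> \<turnstile> f \<Colon> pi_exo A Y" and g: "\<Gamma> \<turnstile> g \<Colon> pi_exo A Y" and h: "inhabited \<Gamma> (homotopies A Y f g)"
  shows "inhabited \<Gamma> (Eq Inn (fmatch k H Y) (App Exo (fmatch_map k A H Y) f) (App Exo (fmatch_map k A H Y) g))"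
proof -
  let ?Y' = "singleton_family A Y f"
  let ?FM = "fmatch k H Y" and ?r = "fmatch_map k A H Y"
  let ?FM' = "fmatch k H ?Y'" and ?r' = "fmatch_map k A H ?Y'"
  let ?\<phi> = "\<lambda>w. App Exo ?r (pointwise_proj1 A Y w)"
  \<comment> \<open>The same map in a context with one more variable: the fixed data are lifted,
    while the argument may mention the new variable.\<close>
  let ?\<phi>1 = "\<lambda>w. App Exo (lift ?r) (pointwise_proj1 (lift A) (lift Y) w)"
  note cA = exotype_imp_ctx[OF A]
  note Y' = typing_singleton_family[OF A Y f]
  note FM = typing_fmatch[OF A H Y] and FM' = typing_fmatch[OF A H Y']
  note r = typing_fmatch_map[OF A H Y] and r' = typing_fmatch_map[OF A H Y']
  note \<Pi>' = exotype_pi_exo[OF A Y']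
  note cFM' = ctx_cons[OF FM'] and c\<Pi>' = exotype_imp_ctx[OF \<Pi>']
  note \<phi> = typing_App_fmatch_map_proj1[OF A H Y f]
  have \<phi>1: "X # \<Gamma> \<turnstile> ?\<phi>1 w \<Colon> lift ?FM"
    if "ctx (X # \<Gamma>)" "X # \<Gamma> \<turnstile> w \<Colon> lift (pi_exo A ?Y')" for X w
    using typing_App_fmatch_map_proj1[OF exotype_lift[OF A that(1)] weakening_pi_fibrant[OF H that(1)]
        weakening_family[OF Y that(1)] weakening_section[OF f that(1)], of w] that(2)
    by (simp add: sigma_simps)
  have "inhabited \<Gamma> (homotopies A Y f f)"
    using inhabited_Pi[OF A exotypeI[OF exotype_homotopies(1)[OF A Y f f]]]
      inhabitedI[OF id_intro[OF typing_fibre[OF A Y]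
          typing_App_section[OF weakening_section[OF f cA] typing_Var0[OF cA]]]] by blast
  then obtain u where u: "\<Gamma> \<turnstile> u \<Colon> pi_exo A ?Y'" and uf: "\<Gamma> \<turnstile> pointwise_proj1 A Y u \<doteq> f \<Colon> pi_exo A Y"
    by (rule singleton_section[OF A Y f f])
  obtain v where v: "\<Gamma> \<turnstile> v \<Colon> pi_exo A ?Y'" and vg: "\<Gamma> \<turnstile> pointwise_proj1 A Y v \<doteq> g \<Colon> pi_exo A Y"
    using h by (rule singleton_section[OF A Y f g])
  obtain s q where s: "\<Gamma> \<turnstile> s \<Colon> arr Exo ?FM' (pi_exo A ?Y')"
    and q: "\<Gamma> \<turnstile> q \<Colon> Eq Exo (arr Exo (pi_exo A ?Y') (pi_exo A ?Y'))
      (comp Exo (pi_exo A ?Y') s ?r') (idfun Exo (pi_exo A ?Y'))"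
    using fmatch_inverse[OF A H Y'] by blast
  obtain w where "\<Gamma> \<turnstile> w \<Colon> contr_fibres A ?Y'"
    using inhabited_contr_singleton_family[OF A Y f] unfolding inhabited_def by blast
  note contr = apply_contr_preserving[OF d Y' this]
  note r'u = typing_App_arr[OF r' u] and r'v = typing_App_arr[OF r' v]
  let ?su = "App Exo s (App Exo ?r' u)" and ?sv = "App Exo s (App Exo ?r' v)"
  note su = typing_App_arr[OF s r'u] and sv = typing_App_arr[OF s r'v]

  \<comment> \<open>The left endpoint stays fixed and the right one varies with a point of FM_Y'.
    This is a family of types over a type, as transport in a contractible type demands.\<close>
  let ?P = "Eq Inn (lift ?FM) (lift (?\<phi> ?su)) (?\<phi>1 (App Exo (lift s) (Var 0)))"
  have "?FM' # \<Gamma> \<turnstile> App Exo (lift s) (Var 0) \<Colon> lift (pi_exo A ?Y')"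
    by (rule typing_App_arr[OF weakening_arr[OF s cFM'] typing_Var0[OF cFM']])
  then have P: "?FM' # \<Gamma> \<turnstile> ?P \<Colon> Univ Inn k"
    by (rule id_form[OF weakening_Univ[OF FM cFM'] weakening[OF \<phi>[OF su] cFM'] \<phi>1[OF cFM']])
  have "inhabited \<Gamma> (inst ?P (App Exo ?r' u))"
    using inhabitedI[OF id_intro[OF FM \<phi>[OF su]]] by (simp add: sigma_simps)
  from contr_transport[OF FM' contr P r'u r'v this]
  have eq_su_sv: "inhabited \<Gamma> (Eq Inn ?FM (?\<phi> ?su) (?\<phi> ?sv))"
    by (simp add: sigma_simps)

  note v0 = typing_Var0[OF c\<Pi>']
  \<comment> \<open>Two families over the sections of singletons follow, one for each endpoint:
    first the round trip is removed from \<open>u\<close>, with the right endpoint still at the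
    round trip of \<open>v\<close>, then from \<open>v\<close>.\<close>
  let ?P = "Eq Inn (lift ?FM) (?\<phi>1 (Var 0)) (lift (?\<phi> ?sv))"
  have P: "exotype (pi_exo A ?Y' # \<Gamma>) ?P"
    by (rule exotypeI[OF id_form[OF weakening_Univ[OF FM c\<Pi>'] \<phi>1[OF c\<Pi>' v0] weakening[OF \<phi>[OF sv] c\<Pi>']]])
  have "inhabited \<Gamma> (inst ?P u)"
    by (rule retract_transport[OF \<Pi>' r' s q P u]) (use eq_su_sv in \<open>simp add: sigma_simps\<close>)
  then have eq_u_sv: "inhabited \<Gamma> (Eq Inn ?FM (?\<phi> u) (?\<phi> ?sv))"
    by (simp add: sigma_simps)

  let ?P = "Eq Inn (lift ?FM) (lift (?\<phi> u)) (?\<phi>1 (Var 0))"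
  have P: "exotype (pi_exo A ?Y' # \<Gamma>) ?P"
    by (rule exotypeI[OF id_form[OF weakening_Univ[OF FM c\<Pi>'] weakening[OF \<phi>[OF u] c\<Pi>'] \<phi>1[OF c\<Pi>' v0]]])
  have "inhabited \<Gamma> (inst ?P v)"
    by (rule retract_transport[OF \<Pi>' r' s q P v]) (use eq_u_sv in \<open>simp add: sigma_simps\<close>)
  then obtain t where t: "\<Gamma> \<turnstile> t \<Colon> Eq Inn ?FM (?\<phi> u) (?\<phi> v)"
    unfolding inhabited_def by (auto simp: sigma_simps)

  \<comment> \<open>The projections of \<open>u\<close> and \<open>v\<close> are convertible to
    \<open>f\<close> and \<open>g\<close>, so the identity already obtained only needs
    retyping.\<close>
  have app: "\<Gamma> \<turnstile> App Exo ?r x \<doteq> App Exo ?r y \<Colon> ?FM" if "\<Gamma> \<turnstile> x \<doteq> y \<Colon> pi_exo A Y" for x y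
    using eq_app[OF eq_refl[OF r[unfolded arr_def]] that] by (simp add: sigma_simps)
  show ?thesis
    by (rule inhabitedI[OF retype[OF t eq_id[OF eq_refl[OF FM] app[OF uf] app[OF vg]]]])
qed


section \<open>Both implications as terms of the theory, and the closed statement\<close>

lemma exotype_contr_preserving:
  assumes A: "exotype \<Gamma> A" and H: "\<Gamma> \<turnstile> H \<Colon> pi_fibrant i k A"
  shows "exotype (families i A # \<Gamma>)
      (arr Exo (contr_fibres (lift A) (Var 0)) (is_contr (fmatch k (lift H) (Var 0))))"
    and "exotype \<Gamma> (contr_preserving i k A H)"
proof -
  note fam = exotype_families[OF A]
  note c = exotype_imp_ctx[OF fam]
  note A1 = exotype_lift[OF A c]
  have Y: "families i A # \<Gamma> \<turnstile> Var 0 \<Colon> families i (lift A)"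
    using typing_Var0[OF c] by (simp add: sigma_simps)
  show *: "exotype (families i A # \<Gamma>)
      (arr Exo (contr_fibres (lift A) (Var 0)) (is_contr (fmatch k (lift H) (Var 0))))"
    by (rule exotype_arr[OF exotype_contr_fibres[OF A1 Y]
          exotypeI[OF typing_is_contr(1)[OF typing_fmatch[OF A1 weakening_pi_fibrant[OF H c] Y]]]])
  show "exotype \<Gamma> (contr_preserving i k A H)"
    unfolding contr_preserving_alt by (rule exotype_Pi[OF fam *])
qed

lemma cofibrant_funext_imp_contr_preserving:
  assumes A: "exotype \<Gamma> A" and H: "\<Gamma> \<turnstile> H \<Colon> pi_fibrant i k A" and F: "\<Gamma> \<turnstile> F \<Colon> cofibrant_funext i k A H"
  shows "inhabited \<Gamma> (contr_preserving i k A H)"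
proof -
  note fam = exotype_families[OF A]
  note c = exotype_imp_ctx[OF fam]
  note A1 = exotype_lift[OF A c] and H1 = weakening_pi_fibrant[OF H c]
    and F1 = weakening_cofibrant_funext[OF F c]
  have Y: "families i A # \<Gamma> \<turnstile> Var 0 \<Colon> families i (lift A)"
    using typing_Var0[OF c] by (simp add: sigma_simps)
  note W = exotype_contr_fibres[OF A1 Y]
  note c' = exotype_imp_ctx[OF W]
  from inhabited_is_contr_fmatch[OF exotype_lift[OF A1 c'] weakening_pi_fibrant[OF H1 c']
      weakening_family[OF Y c'] weakening_cofibrant_funext[OF F1 c'], of "Var 0"]
  have "inhabited (contr_fibres (lift A) (Var 0) # families i A # \<Gamma>)
      (lift (is_contr (fmatch k (lift H) (Var 0))))"
    using typing_Var0[OF c'] by (simp add: sigma_simps)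
  from inhabited_arr[OF W exotypeI[OF typing_is_contr(1)[OF typing_fmatch[OF A1 H1 Y]]] this]
  show ?thesis
    unfolding contr_preserving_alt by (rule inhabited_Pi[OF fam exotype_contr_preserving(1)[OF A H]])
qed

lemma exotype_cofibrant_funext_conclusion:
  assumes A: "exotype \<Gamma> A" and H: "\<Gamma> \<turnstile> H \<Colon> pi_fibrant i k A" and Y: "\<Gamma> \<turnstile> Y \<Colon> families i A"
    and f: "\<Gamma> \<turnstile> f \<Colon> pi_exo A Y" and g: "\<Gamma> \<turnstile> g \<Colon> pi_exo A Y"
  shows "exotype \<Gamma>
    (Eq Inn (fmatch k H Y) (App Exo (fmatch_map k A H Y) f) (App Exo (fmatch_map k A H Y) g))"
  using typing_App_arr[OF typing_fmatch_map[OF A H Y]] f g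
  by (blast intro: exotypeI id_form typing_fmatch[OF A H Y])

text \<open>Well-formedness and inhabitation are derived together because they share the chain of
  contexts introducing \<open>Y\<close>, \<open>f\<close> and \<open>g\<close>.\<close>

lemma inhabited_cofibrant_funext:
  fixes i k A H \<Gamma>
  defines "\<Delta> \<equiv> pi_exo (lift (lift A)) (Var 1) # pi_exo (lift A) (Var 0) # families i A # \<Gamma>"
  defines "A' \<equiv> lift (lift (lift A))" and "H' \<equiv> lift (lift (lift H))"
  defines "T \<equiv> arr Exo (homotopies A' (Var 2) (Var 1) (Var 0))
     (Eq Inn (fmatch k H' (Var 2)) (App Exo (fmatch_map k A' H' (Var 2)) (Var 1))
       (App Exo (fmatch_map k A' H' (Var 2)) (Var 0)))"
  assumes A: "exotype \<Gamma> A" and H: "\<Gamma> \<turnstile> H \<Colon> pi_fibrant i k A"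
  shows "exotype \<Gamma> (cofibrant_funext i k A H)"
    and "\<Gamma> \<turnstile> d \<Colon> contr_preserving i k A H \<Longrightarrow> inhabited \<Gamma> (cofibrant_funext i k A H)"
proof -
  note fam = exotype_families[OF A]
  note c1 = exotype_imp_ctx[OF fam]
  note A1 = exotype_lift[OF A c1]
  have Y1: "families i A # \<Gamma> \<turnstile> Var 0 \<Colon> families i (lift A)"
    using typing_Var0[OF c1] by (simp add: sigma_simps)
  note X1 = exotype_pi_exo[OF A1 Y1]
  note c2 = exotype_imp_ctx[OF X1]
  note A2 = exotype_lift[OF A1 c2]
  have Y2: "pi_exo (lift A) (Var 0) # families i A # \<Gamma> \<turnstile> Var 1 \<Colon> families i (lift (lift A))"
    using weakening_family[OF Y1 c2] by (simp add: sigma_simps)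
  note X2 = exotype_pi_exo[OF A2 Y2]
  note c3 = exotype_imp_ctx[OF X2]
  have A3: "exotype \<Delta> A'" and H3: "\<Delta> \<turnstile> H' \<Colon> pi_fibrant i k A'"
    unfolding A'_def H'_def \<Delta>_def
    by (rule exotype_lift[OF A2 c3],
        rule weakening_pi_fibrant[OF weakening_pi_fibrant[OF weakening_pi_fibrant[OF H c1] c2] c3])
  have Y3: "\<Delta> \<turnstile> Var 2 \<Colon> families i A'" and f: "\<Delta> \<turnstile> Var 1 \<Colon> pi_exo A' (Var 2)" and g: "\<Delta> \<turnstile> Var 0 \<Colon> pi_exo A' (Var 2)"
    using weakening_family[OF Y2 c3] typing_Var1[OF c3] typing_Var0[OF c3]
    by (simp_all add: \<Delta>_def A'_def sigma_simps)
  note Hom = exotype_homotopies(2)[OF A3 Y3 f g]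
    and Concl = exotype_cofibrant_funext_conclusion[OF A3 H3 Y3 f g]
  have T: "exotype \<Delta> T"
    unfolding T_def by (rule exotype_arr[OF Hom Concl])
  have alt: "cofibrant_funext i k A H =
      Pi Exo (families i A) (Pi Exo (pi_exo (lift A) (Var 0)) (Pi Exo (pi_exo (lift (lift A)) (Var 1)) T))"
    by (simp add: cofibrant_funext_alt T_def A'_def H'_def)
  note T2 = exotype_Pi[OF X2 T[unfolded \<Delta>_def]]
  note T1 = exotype_Pi[OF X1 T2]
  show "exotype \<Gamma> (cofibrant_funext i k A H)"
    unfolding alt by (rule exotype_Pi[OF fam T1])
  assume d: "\<Gamma> \<turnstile> d \<Colon> contr_preserving i k A H"
  note c4 = exotype_imp_ctx[OF Hom]
  have d3: "\<Delta> \<turnstile> lift (lift (lift d)) \<Colon> contr_preserving i k A' H'"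
    unfolding A'_def H'_def \<Delta>_def
    by (rule weakening_contr_preserving[OF weakening_contr_preserving[OF weakening_contr_preserving[OF d c1] c2] c3])
  let ?Hom = "homotopies A' (Var 2) (Var 1) (Var 0)"
  \<comment> \<open>The hypothesis of the arrow, now the most recent variable, is itself the
    homotopy required.\<close>
  have "inhabited (?Hom # \<Delta>) (homotopies (lift A') (lift (Var 2)) (lift (Var 1)) (lift (Var 0)))"
    using inhabitedI[OF typing_Var0[OF c4]] by (simp add: sigma_simps)
  from inhabited_fmatch_homotopy[OF exotype_lift[OF A3 c4] weakening_pi_fibrant[OF H3 c4]
      weakening_family[OF Y3 c4] weakening_contr_preserving[OF d3 c4] weakening_section[OF f c4]
      weakening_section[OF g c4] this]
  have "inhabited (?Hom # \<Delta>) (lift (Eq Inn (fmatch k H' (Var 2)) (App Exo (fmatch_map k A' H' (Var 2)) (Var 1))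
       (App Exo (fmatch_map k A' H' (Var 2)) (Var 0))))"
    by (simp add: sigma_simps)
  from inhabited_arr[OF Hom Concl this] have "inhabited \<Delta> T"
    by (simp only: T_def)
  from inhabited_Pi[OF fam T1 inhabited_Pi[OF X1 T2 inhabited_Pi[OF X2 T[unfolded \<Delta>_def] this[unfolded \<Delta>_def]]]]
  show "inhabited \<Gamma> (cofibrant_funext i k A H)"
    unfolding alt .
qed

lemma inhabited_exo_iff:
  assumes A: "exotype \<Gamma> A" and H: "\<Gamma> \<turnstile> H \<Colon> pi_fibrant i k A"
  shows "exotype \<Gamma> (exo_iff (contr_preserving i k A H) (cofibrant_funext i k A H))"
    and "inhabited \<Gamma> (exo_iff (contr_preserving i k A H) (cofibrant_funext i k A H))"
proof -
  let ?C = "contr_preserving i k A H" and ?F = "cofibrant_funext i k A H"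
  note C = exotype_contr_preserving(2)[OF A H] and F = inhabited_cofibrant_funext(1)[OF A H]
  show "exotype \<Gamma> (exo_iff ?C ?F)"
    unfolding exo_iff_def by (intro exotype_times exotype_arr C F)
  have "inhabited (?C # \<Gamma>) (lift ?F)"
  proof -
    note c = exotype_imp_ctx[OF C]
    have "?C # \<Gamma> \<turnstile> Var 0 \<Colon> contr_preserving i k (lift A) (lift H)"
      using typing_Var0[OF c] by (simp add: sigma_simps)
    from inhabited_cofibrant_funext(2)[OF exotype_lift[OF A c] weakening_pi_fibrant[OF H c] this]
    show ?thesis
      by (simp add: sigma_simps)
  qed
  note CF = inhabited_arr[OF C F this]
  have "inhabited (?F # \<Gamma>) (lift ?C)"
  proof -
    note c = exotype_imp_ctx[OF F]
    have "?F # \<Gamma> \<turnstile> Var 0 \<Colon> cofibrant_funext i k (lift A) (lift H)"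
      using typing_Var0[OF c] by (simp add: sigma_simps)
    from cofibrant_funext_imp_contr_preserving[OF exotype_lift[OF A c] weakening_pi_fibrant[OF H c] this]
    show ?thesis
      by (simp add: sigma_simps)
  qed
  note FC = inhabited_arr[OF F C this]
  show "inhabited \<Gamma> (exo_iff ?C ?F)"
    unfolding exo_iff_def by (rule inhabited_times[OF exotype_arr[OF C F] exotype_arr[OF F C] CF FC])
qed

theorem proposition2p14:
  fixes i j k :: nat
  shows "\<exists>t. [] \<turnstile> t \<Colon>
    Pi Exo (Univ Exo j) (Pi Exo (pi_fibrant i k (Var 0))
      (exo_iff (contr_preserving i k (Var 1) (Var 0)) (cofibrant_funext i k (Var 1) (Var 0))))"
proof -
  have U: "exotype [] (Univ Exo j)"
    by (rule exotype_Univ[OF ctx_nil])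
  note c = exotype_imp_ctx[OF U]
  have A: "[Univ Exo j] \<turnstile> Var 0 \<Colon> Univ Exo j"
    using typing_Var0[OF c] by (simp add: sigma_simps)
  note PF = exotype_pi_fibrant[OF exotypeI[OF A]]
  \<comment> \<open>In this context \<open>Var 1\<close> is the exo-type A and \<open>Var 0\<close>
    the witness that chooses the fibrant matches.\<close>
  have "pi_fibrant i k (Var 0) # [Univ Exo j] \<turnstile> Var 1 \<Colon> Univ Exo j"
    using weakening[OF A exotype_imp_ctx[OF PF]] by (simp add: sigma_simps)
  moreover have "pi_fibrant i k (Var 0) # [Univ Exo j] \<turnstile> Var 0 \<Colon> pi_fibrant i k (Var 1)"
    using typing_Var0[OF exotype_imp_ctx[OF PF]] by (simp add: sigma_simps)
  ultimately have iff: "exotype (pi_fibrant i k (Var 0) # [Univ Exo j])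
        (exo_iff (contr_preserving i k (Var 1) (Var 0)) (cofibrant_funext i k (Var 1) (Var 0)))"
    "inhabited (pi_fibrant i k (Var 0) # [Univ Exo j])
        (exo_iff (contr_preserving i k (Var 1) (Var 0)) (cofibrant_funext i k (Var 1) (Var 0)))"
    by (blast intro: inhabited_exo_iff exotypeI)+
  show ?thesis
    using inhabited_Pi[OF U exotype_Pi[OF PF iff(1)] inhabited_Pi[OF PF iff]] unfolding inhabited_def .
qed

end
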